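(* Consider, in the coordinates $(\boldsymbol\varphi,\boldsymbol p,\mathbf R,\boldsymbol\sigma)$ on $[0,L]$, the Hamiltonian $$H(\boldsymbol\varphi,\boldsymbol p,\mathbf R,\boldsymbol\sigma)=\frac12\int_0^L\Big(\langle\boldsymbol p,\mathbb A^{-1}\boldsymbol p\rangle+\langle\boldsymbol\sigma,\mathbb J^{-1}\boldsymbol\sigma\rangle+\big\langle\tfrac{\partial\boldsymbol\varphi}{\partial S}-\boldsymbol d_3,\mathbb G\big(\tfrac{\partial\boldsymbol\varphi}{\partial S}-\boldsymbol d_3\big)\big\rangle+\big\langle j(\mathbf R^{-1}\tfrac{\partial\mathbf R}{\partial S}),\mathbb H\,j(\mathbf R^{-1}\tfrac{\partial\mathbf R}{\partial S})\big\rangle\Big)dS$$ and the bracket $$\{f,g\}=\int_0^L\Big\langle\frac{\partial f}{\partial\boldsymbol\varphi},\frac{\partial g}{\partial\boldsymbol p}\Big\rangle-\Big\langle\frac{\partial g}{\partial\boldsymbol\varphi},\frac{\partial f}{\partial\boldsymbol p}\Big\rangle+\Big\langle\!\Big\langle\frac{\partial f}{\partial\mathbf R},\mathbf R j^{-1}\Big(\frac{\partial g}{\partial\boldsymbol\sigma}\Big)\Big\rangle\!\Big\rangle-\Big\langle\!\Big\langle\frac{\partial g}{\partial\mathbf R},\mathbf R j^{-1}\Big(\frac{\partial f}{\partial\boldsymbol\sigma}\Big)\Big\rangle\!\Big\rangle\,dS .$$ Assume the boundary conditions $\langle\delta\boldsymbol\varphi,\mathbb G\boldsymbol\varepsilon\rangle=0$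 and $\langle\delta\boldsymbol\theta,\mathbb H\boldsymbol\kappa\rangle=0$ at $S=0$ and $S=L$, at any time, for the perturbations considered. Then the equations of motion $$\frac{\partial\boldsymbol\varphi}{\partial t}=\mathbb A^{-1}\boldsymbol p,\quad \frac{\partial\boldsymbol p}{\partial t}=\frac{\partial(\mathbb G\boldsymbol\varepsilon)}{\partial S},\quad \frac{\partial\mathbf R}{\partial t}=\mathbf R\,j^{-1}(\mathbb J^{-1}\boldsymbol\sigma),\quad \frac{\partial\boldsymbol\sigma}{\partial t}=\frac{\partial(\mathbb H\boldsymbol\kappa)}{\partial S}+\frac{\partial\boldsymbol\varphi}{\partial S}\wedge(\mathbb G\boldsymbol\varepsilon)$$ are Hamiltonian for this bracket and this Hamiltonian, i.e. they are the equations $\partial_t x=\{x,H\}$ for $x\in\{\boldsymbol\varphi,\boldsymbol p,\mathbf R,\boldsymbol\sigma\}$.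
   Context: All fields on $[0,L]$ are smooth. $\langle\cdot,\cdot\rangle$ is the Euclidean scalar product of $\mathbb R^3$, $\wedge$ the cross product, and $\langle\langle A,B\rangle\rangle=\frac12\mathrm{Tr}(A^TB)$ for $3\times3$ matrices. $(\boldsymbol e_1,\boldsymbol e_2,\boldsymbol e_3)$ is a fixed positively oriented orthonormal basis, identified with the canonical basis of $\mathbb R^3$; $\mathbf R(S)\in SO(3)$ and the moving frame is $\boldsymbol d_i=\mathbf R\boldsymbol e_i$. A bold vector $\boldsymbol u=u_i\boldsymbol d_i$ is a vector of the ambient $\mathbb R^3$ with moving-frame components $u=\mathbf R^{-1}\boldsymbol u$; derivatives in $S,t$ of bold vectors are those of $\mathbb R^3$-valued functions (the frame is differentiated too). The map $j:so(3)\to\mathbb R^3$ sends a skew matrix $A$ to the column $a$ with $Ax=a\wedge x$ for all $x$. When $j$ or $j^{-1}$ is used with bold vectors, the column is the column of moving components: $j^{-1}(\boldsymbol u)$ is the skew matrix $j^{-1}(u)$, and $j(A)$ is identified with the bold vector whose moving components are $j(A)$. In particular $\boldsymbol\kappa=j(\mathbf R^{-1}\partial_S\mathbf R)$ and $\boldsymbol\varepsilon=\partial_S\boldsymbol\varphi-\boldsymbol d_3$. The tensors are diagonal with constant positive entries in the moving frame: $\mathbb G=\mathrm{diag}(GA,GA,EA)$, $\mathbb H=\mathrm{diag}(EI_1,EI_2,GI_3)$, $\mathbb A=\rho A\,\mathrm{Id}$, $\mathbb J=\rho\,\mathrm{diag}(I_1,I_2,I_3)$; $\mathbb X\boldsymbol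 u$ is the bold vector with moving components $\mathbb Xu$. Here $\boldsymbol p$ is the position momentum and $\boldsymbol\sigma=j(\mathbf R^{-1}\Sigma)$ is the rotation momentum $\Sigma\in T^*_{\mathbf R}SO(3)$ (represented as a matrix in $T_{\mathbf R}SO(3)$ via $\langle\langle\cdot,\cdot\rangle\rangle$) written on the moving frame. The variables $\boldsymbol\varphi,\boldsymbol p,\mathbf R,\boldsymbol\sigma$ are independent coordinates. Partial derivatives are functional (gradient) derivatives with respect to the pairings $\int_0^L\langle\cdot,\cdot\rangle dS$ and $\int_0^L\langle\langle\cdot,\cdot\rangle\rangle dS$: e.g. $\int_0^L\langle\partial f/\partial\boldsymbol\varphi,\delta\boldsymbol\varphi\rangle dS$ is the first variation of $f$ under $\delta\boldsymbol\varphi$. The derivative $\partial f/\partial\mathbf R$ (at each $S$ an element of $T_{\mathbf R}SO(3)=\mathbf R\,so(3)$) is taken along $\delta\mathbf R\in T_{\mathbf R}SO(3)$ with $\boldsymbol\varphi$, $\boldsymbol p$ fixed and with the moving-frame components of $\boldsymbol\sigma$ fixed (as $\boldsymbol\sigma=j(\mathbf R^{-1}\Sigma)$ is defined through left translation to the moving frame). For such perturbations $\delta\boldsymbol\theta$ denotes the bold vector $j(\mathbf R^{-1}\delta\mathbf R)$, so that $\delta\boldsymbol d_i=\delta\boldsymbol\theta\wedge\boldsymbol d_i$. With coordinates regarded as independent variables, the bracket formula gives $\{\boldsymbol\varphi,H\}=\frac{\partial H}{\partial\boldsymbol p}$, $\{\boldsymbol p,H\}=-\frac{\partial H}{\partial\boldsymbol\varphi}$,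 $\{\mathbf R,H\}=\mathbf R j^{-1}\big(\frac{\partial H}{\partial\boldsymbol\sigma}\big)$, $\{\boldsymbol\sigma,H\}=-j\big(\mathbf R^{-1}\frac{\partial H}{\partial\mathbf R}\big)$; this is the meaning of $\{x,H\}$ in the claim. *)

theory Defs
  imports "HOL-Analysis.Analysis"
begin

type_synonym vfield = "real \<Rightarrow> real^3"
type_synonym mfield = "real \<Rightarrow> real^3^3"

(* Functionals of (phi, p, R, sigma), with sigma an ambient ("bold") vector field. *)
type_synonym functional = "vfield \<Rightarrow> vfield \<Rightarrow> mfield \<Rightarrow> vfield \<Rightarrow> real"

(* (df/dphi, df/dp, df/dR, df/dsigma) *)
type_synonym gradient = "vfield \<times> vfield \<times> mfield \<times> vfield"


text \<open>Smoothness on the closed interval, with one-sided derivatives at the end points: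
  \<open>D k\<close> is the \<open>k\<close>-th derivative. Values of \<open>f\<close> outside \<open>[0, L]\<close> play no role.\<close>

definition smooth_field :: "real \<Rightarrow> (real \<Rightarrow> 'a::real_normed_vector) \<Rightarrow> bool" where
  "smooth_field L f \<longleftrightarrow> (\<exists>D. D (0::nat) = f \<and>
     (\<forall>k. \<forall>S\<in>{0..L}. (D k has_vector_derivative D (Suc k) S) (at S within {0..L})))"

text \<open>Joint smoothness of \<open>f t S\<close> on \<open>T \<times> [0, L]\<close>, with \<open>D i j\<close> the derivative of order \<open>i\<close>
  in \<open>t\<close> and \<open>j\<close> in \<open>S\<close>.\<close>

definition smooth_family ::
  "real set \<Rightarrow> real \<Rightarrow> (real \<Rightarrow> real \<Rightarrow> 'a::real_normed_vector) \<Rightarrow> bool" where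
  "smooth_family T L f \<longleftrightarrow> (\<exists>D. D (0::nat) (0::nat) = f \<and>
     (\<forall>i j. continuous_on (Sigma T (\<lambda>_. {0..L})) (\<lambda>x. D i j (fst x) (snd x)) \<and>
        (\<forall>t\<in>T. \<forall>S\<in>{0..L}.
           ((\<lambda>t'. D i j t' S) has_vector_derivative D (Suc i) j t S) (at t within T) \<and>
           (D i j t has_vector_derivative D i (Suc j) t S) (at S within {0..L}))))"

definition dS :: "real \<Rightarrow> (real \<Rightarrow> 'a::real_normed_vector) \<Rightarrow> real \<Rightarrow> 'a" where
  "dS L f S = vector_derivative f (at S within {0..L})"


definition skew :: "real^3^3 \<Rightarrow> bool" where
  "skew A \<longleftrightarrow> transpose A = - A"

definition jmap :: "real^3^3 \<Rightarrow> real^3" where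
  "jmap A = (THE a. \<forall>x. A *v x = cross3 a x)"

definition jinv :: "real^3 \<Rightarrow> real^3^3" where
  "jinv a = matrix (\<lambda>x. cross3 a x)"

definition mat_pairing :: "real^3^3 \<Rightarrow> real^3^3 \<Rightarrow> real" where
  "mat_pairing A B = trace (transpose A ** B) / 2"

definition tangent_SO3 :: "real^3^3 \<Rightarrow> (real^3^3) set" where
  "tangent_SO3 Q = {Q ** W | W. skew W}"

definition diag3 :: "real \<Rightarrow> real \<Rightarrow> real \<Rightarrow> real^3^3" where
  "diag3 a b c = (\<chi> i j. if i = j then (vector [a, b, c] :: real^3) $ i else 0)"


text \<open>Passage between an ambient vector and its column of components in the moving frame
  \<open>d\<^sub>i = Q e\<^sub>i\<close>; tensors and the maps \<open>j\<close>, \<open>j\<^sup>-\<^sup>1\<close> act on bold vectors through components.\<close>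

definition comps :: "real^3^3 \<Rightarrow> real^3 \<Rightarrow> real^3" where
  "comps Q u = matrix_inv Q *v u"

definition bold :: "real^3^3 \<Rightarrow> real^3 \<Rightarrow> real^3" where
  "bold Q a = Q *v a"

definition tensor :: "real^3^3 \<Rightarrow> real^3^3 \<Rightarrow> real^3 \<Rightarrow> real^3" where
  "tensor X Q u = bold Q (X *v comps Q u)"

definition bold_j :: "real^3^3 \<Rightarrow> real^3^3 \<Rightarrow> real^3" where
  "bold_j Q A = bold Q (jmap A)"

definition bold_jinv :: "real^3^3 \<Rightarrow> real^3 \<Rightarrow> real^3^3" where
  "bold_jinv Q u = jinv (comps Q u)"

definition strain :: "real \<Rightarrow> vfield \<Rightarrow> mfield \<Rightarrow> vfield" where
  "strain L \<phi> R S = dS L \<phi> S - R S *v axis 3 1"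

definition curvature :: "real \<Rightarrow> mfield \<Rightarrow> vfield" where
  "curvature L R S = bold_j (R S) (matrix_inv (R S) ** dS L R S)"

definition rod_hamiltonian ::
  "real \<Rightarrow> real^3^3 \<Rightarrow> real^3^3 \<Rightarrow> real^3^3 \<Rightarrow> real^3^3 \<Rightarrow> functional" where
  "rod_hamiltonian L \<AA> \<JJ> \<GG> \<HH> \<phi> p R \<sigma> = 1/2 * integral {0..L} (\<lambda>S.
       p S \<bullet> tensor (matrix_inv \<AA>) (R S) (p S)
     + \<sigma> S \<bullet> tensor (matrix_inv \<JJ>) (R S) (\<sigma> S)
     + strain L \<phi> R S \<bullet> tensor \<GG> (R S) (strain L \<phi> R S)
     + curvature L R S \<bullet> tensor \<HH> (R S) (curvature L R S))"


text \<open>\<open>V\<phi>\<close> and \<open>V\<theta>\<close> are the classes of admissible perturbations \<open>\<delta>\<phi>\<close> and \<open>\<delta>\<theta>\<close>;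
  perturbations of \<open>p\<close> and \<open>\<sigma>\<close> are unrestricted.\<close>

definition is_grad_phi ::
  "real \<Rightarrow> vfield set \<Rightarrow> functional \<Rightarrow> vfield \<Rightarrow> vfield \<Rightarrow> mfield \<Rightarrow> vfield \<Rightarrow> vfield \<Rightarrow> bool" where
  "is_grad_phi L V\<phi> F \<phi> p R \<sigma> g \<longleftrightarrow> smooth_field L g \<and> (\<forall>\<delta>\<in>V\<phi>.
     ((\<lambda>s. F (\<lambda>S. \<phi> S + s *\<^sub>R \<delta> S) p R \<sigma>) has_real_derivative
        integral {0..L} (\<lambda>S. g S \<bullet> \<delta> S)) (at 0))"

definition is_grad_p ::
  "real \<Rightarrow> functional \<Rightarrow> vfield \<Rightarrow> vfield \<Rightarrow> mfield \<Rightarrow> vfield \<Rightarrow> vfield \<Rightarrow> bool" where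
  "is_grad_p L F \<phi> p R \<sigma> g \<longleftrightarrow> smooth_field L g \<and> (\<forall>\<delta>. smooth_field L \<delta> \<longrightarrow>
     ((\<lambda>s. F \<phi> (\<lambda>S. p S + s *\<^sub>R \<delta> S) R \<sigma>) has_real_derivative
        integral {0..L} (\<lambda>S. g S \<bullet> \<delta> S)) (at 0))"

definition is_grad_sigma ::
  "real \<Rightarrow> functional \<Rightarrow> vfield \<Rightarrow> vfield \<Rightarrow> mfield \<Rightarrow> vfield \<Rightarrow> vfield \<Rightarrow> bool" where
  "is_grad_sigma L F \<phi> p R \<sigma> g \<longleftrightarrow> smooth_field L g \<and> (\<forall>\<delta>. smooth_field L \<delta> \<longrightarrow>
     ((\<lambda>s. F \<phi> p R (\<lambda>S. \<sigma> S + s *\<^sub>R \<delta> S)) has_real_derivative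
        integral {0..L} (\<lambda>S. g S \<bullet> \<delta> S)) (at 0))"

text \<open>A perturbation \<open>\<delta>R\<close> of the rotation field is realised by an arbitrary smooth
  one-parameter family of rotation fields \<open>Q s\<close> through \<open>R\<close> with velocity \<open>\<delta>R\<close> at \<open>s = 0\<close>. Along
  the family the moving-frame components of \<open>\<sigma>\<close> are kept fixed, so the ambient vector \<open>\<sigma>\<close> is
  carried along by the frame.\<close>

definition is_grad_R ::
  "real \<Rightarrow> vfield set \<Rightarrow> functional \<Rightarrow> vfield \<Rightarrow> vfield \<Rightarrow> mfield \<Rightarrow> vfield \<Rightarrow> mfield \<Rightarrow> bool" where
  "is_grad_R L V\<theta> F \<phi> p R \<sigma> g \<longleftrightarrow> smooth_field L g \<and>
     (\<forall>S\<in>{0..L}. g S \<in> tangent_SO3 (R S)) \<and>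
     (\<forall>\<delta>R \<delta>\<theta> Q r.
        \<delta>\<theta> \<in> V\<theta> \<and>
        (\<forall>S\<in>{0..L}. \<delta>R S \<in> tangent_SO3 (R S) \<and>
                     \<delta>\<theta> S = bold_j (R S) (matrix_inv (R S) ** \<delta>R S)) \<and>
        0 < r \<and> smooth_family {-r<..<r} L Q \<and>
        (\<forall>s\<in>{-r<..<r}. \<forall>S\<in>{0..L}. rotation_matrix (Q s S)) \<and>
        (\<forall>S\<in>{0..L}. Q 0 S = R S \<and> ((\<lambda>s. Q s S) has_vector_derivative \<delta>R S) (at 0))
      \<longrightarrow> ((\<lambda>s. F \<phi> p (Q s) (\<lambda>S. bold (Q s S) (comps (R S) (\<sigma> S)))) has_real_derivative
             integral {0..L} (\<lambda>S. mat_pairing (g S) (\<delta>R S))) (at 0))"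

definition is_gradient ::
  "real \<Rightarrow> vfield set \<Rightarrow> vfield set \<Rightarrow> functional \<Rightarrow> vfield \<Rightarrow> vfield \<Rightarrow> mfield \<Rightarrow> vfield \<Rightarrow> gradient \<Rightarrow> bool" where
  "is_gradient L V\<phi> V\<theta> F \<phi> p R \<sigma> dF \<longleftrightarrow> (case dF of (g\<phi>, gp, gR, g\<sigma>) \<Rightarrow>
     is_grad_phi L V\<phi> F \<phi> p R \<sigma> g\<phi> \<and> is_grad_p L F \<phi> p R \<sigma> gp \<and>
     is_grad_R L V\<theta> F \<phi> p R \<sigma> gR \<and> is_grad_sigma L F \<phi> p R \<sigma> g\<sigma>)"


text \<open>The bracket \<open>{f, g}\<close> at a configuration with rotation field \<open>R\<close>, as a function of the
  functional derivatives of \<open>f\<close> and \<open>g\<close> there.\<close>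

definition rod_bracket :: "real \<Rightarrow> mfield \<Rightarrow> gradient \<Rightarrow> gradient \<Rightarrow> real" where
  "rod_bracket L R df dg = (case df of (f\<phi>, fp, fR, f\<sigma>) \<Rightarrow> case dg of (g\<phi>, gp, gR, g\<sigma>) \<Rightarrow>
     integral {0..L} (\<lambda>S.
         f\<phi> S \<bullet> gp S - g\<phi> S \<bullet> fp S
       + mat_pairing (fR S) (R S ** bold_jinv (R S) (g\<sigma> S))
       - mat_pairing (gR S) (R S ** bold_jinv (R S) (f\<sigma> S))))"

text \<open>The brackets \<open>{x, H}\<close> of the coordinates, regarded as independent variables, in terms of the
  functional derivatives \<open>dH\<close> of \<open>H\<close>.\<close>

definition bracket_phi :: "gradient \<Rightarrow> vfield" where
  "bracket_phi dH = (case dH of (h\<phi>, hp, hR, h\<sigma>) \<Rightarrow> hp)"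

definition bracket_p :: "gradient \<Rightarrow> vfield" where
  "bracket_p dH = (case dH of (h\<phi>, hp, hR, h\<sigma>) \<Rightarrow> (\<lambda>S. - h\<phi> S))"

definition bracket_R :: "mfield \<Rightarrow> gradient \<Rightarrow> mfield" where
  "bracket_R R dH = (case dH of (h\<phi>, hp, hR, h\<sigma>) \<Rightarrow> (\<lambda>S. R S ** bold_jinv (R S) (h\<sigma> S)))"

definition bracket_sigma :: "mfield \<Rightarrow> gradient \<Rightarrow> vfield" where
  "bracket_sigma R dH = (case dH of (h\<phi>, hp, hR, h\<sigma>) \<Rightarrow>
     (\<lambda>S. - bold_j (R S) (matrix_inv (R S) ** hR S)))"

text \<open>These expressions are the ones the bracket yields: for each coordinate \<open>x\<close>, pairing
  \<open>{x, H}\<close> with a test field \<open>w\<close> gives the bracket of \<open>H\<close> with the coordinate \<open>x\<close> smeared by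
  \<open>w\<close>, whose only nonzero derivative is \<open>w\<close> in the slot of \<open>x\<close>.\<close>

definition coordinate_brackets_from_bracket :: "real \<Rightarrow> mfield \<Rightarrow> gradient \<Rightarrow> bool" where
  "coordinate_brackets_from_bracket L R dH \<longleftrightarrow>
     (\<forall>w. smooth_field L w \<longrightarrow>
        integral {0..L} (\<lambda>S. w S \<bullet> bracket_phi dH S)
          = rod_bracket L R (w, \<lambda>_. 0, \<lambda>_. 0, \<lambda>_. 0) dH \<and>
        integral {0..L} (\<lambda>S. w S \<bullet> bracket_p dH S)
          = rod_bracket L R (\<lambda>_. 0, w, \<lambda>_. 0, \<lambda>_. 0) dH \<and>
        integral {0..L} (\<lambda>S. w S \<bullet> bracket_sigma R dH S)
          = rod_bracket L R (\<lambda>_. 0, \<lambda>_. 0, \<lambda>_. 0, w) dH) \<and>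
     (\<forall>W. smooth_field L W \<and> (\<forall>S\<in>{0..L}. W S \<in> tangent_SO3 (R S)) \<longrightarrow>
        integral {0..L} (\<lambda>S. mat_pairing (W S) (bracket_R R dH S))
          = rod_bracket L R (\<lambda>_. 0, \<lambda>_. 0, W, \<lambda>_. 0) dH)"

end

theory Submission
  imports Defs
begin

text \<open>
  Write \<open>n = \<GG>\<epsilon>\<close> and \<open>m = \<HH>\<kappa>\<close>. The Hamiltonian is quadratic in \<open>\<phi>\<close>, \<open>p\<close> and \<open>\<sigma>\<close>, so these three
  derivatives are read off. Along a family of rotation fields only the components
  \<open>\<Gamma> = R\<^sup>T \<phi>' - e\<^sub>3\<close> and \<open>K = j (R\<^sup>T R')\<close> vary, with \<open>\<GG>\<Gamma> \<bullet> \<delta>\<Gamma> = - \<delta>\<theta> \<bullet> (\<phi>' \<times> n)\<close> and \<open>R \<delta>K = (\<delta>\<theta>)'\<close>; the latter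
  uses that mixed derivatives of the family commute. An integration by parts, whose boundary
  terms vanish by assumption, then gives the derivative in \<open>R\<close>. Conversely, any other gradient agrees
  with this one on \<open>[0, L]\<close>, since perturbations vanishing at the ends separate smooth fields; for
  \<open>R\<close> this requires realising each such perturbation by a smooth family of rotation fields.
\<close>

section \<open>Smooth families and fields\<close>

text \<open>Only \<open>\<Gamma>\<close> and \<open>K\<close> vary with the frame for two different
  reasons. The tensor \<open>\<AA>\<close> is a multiple of the identity, so the energy of
  \<open>p\<close> does not see the frame although \<open>p\<close> is held fixed as an ambient
  vector; the energy of \<open>\<sigma>\<close> depends on moving components alone, and these are
  what is held fixed. Hence the last equation carries no cross product of momenta. Since the third
  basis vector is constant in components, it drops out of the variation of \<open>\<Gamma>\<close>,
  and the cross product with the force contains the whole of \<open>\<phi>'\<close> rather than the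
  strain.

  The obstacle is that a gradient in \<open>R\<close> is tested against every smooth family of
  rotations. Existence must therefore work with an unknown family and find a derivative that depends
  on its initial velocity only; uniqueness must exhibit families whose full array of mixed
  derivatives exists. The second task is the origin of the calculus of
  \<open>C_family\<close>.\<close>

text \<open>Recursion on the order makes each closure property a single induction; with the array of
  \<open>smooth_family\<close> it would be a Leibniz formula in two indices. Nothing is asked here
  about the mixed partials being equal: that is recovered in
  \<open>mixed_partial_derivatives\<close>.\<close>

primrec C_family :: "nat \<Rightarrow> real set \<Rightarrow> real \<Rightarrow> (real \<Rightarrow> real \<Rightarrow> 'a::real_normed_vector) \<Rightarrow> bool" where
  "C_family 0 T L f \<longleftrightarrow> continuous_on (Sigma T (\<lambda>_. {0..L})) (\<lambda>x. f (fst x) (snd x))"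
| "C_family (Suc n) T L f \<longleftrightarrow>
     continuous_on (Sigma T (\<lambda>_. {0..L})) (\<lambda>x. f (fst x) (snd x)) \<and>
     (\<exists>ft fS. C_family n T L ft \<and> C_family n T L fS \<and>
        (\<forall>t\<in>T. \<forall>S\<in>{0..L}. ((\<lambda>t'. f t' S) has_vector_derivative ft t S) (at t within T) \<and>
                            (f t has_vector_derivative fS t S) (at S within {0..L})))"

lemma C_family_continuous:
  "C_family n T L f \<Longrightarrow> continuous_on (Sigma T (\<lambda>_. {0..L})) (\<lambda>x. f (fst x) (snd x))"
  by (cases n) auto

lemma C_family_SucI:
  assumes "C_family n T L f" "C_family n T L ft" "C_family n T L fS"
    and "\<And>t S. t \<in> T \<Longrightarrow> S \<in> {0..L} \<Longrightarrow> ((\<lambda>t'. f t' S) has_vector_derivative ft t S) (at t within T)"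
    and "\<And>t S. t \<in> T \<Longrightarrow> S \<in> {0..L} \<Longrightarrow> (f t has_vector_derivative fS t S) (at S within {0..L})"
  shows "C_family (Suc n) T L f"
  using C_family_continuous[OF assms(1)] assms(2-5) unfolding C_family.simps by blast

lemma C_family_SucE:
  assumes "C_family (Suc n) T L f"
  obtains ft fS where "C_family n T L ft" "C_family n T L fS"
    and "\<And>t S. t \<in> T \<Longrightarrow> S \<in> {0..L} \<Longrightarrow> ((\<lambda>t'. f t' S) has_vector_derivative ft t S) (at t within T)"
    and "\<And>t S. t \<in> T \<Longrightarrow> S \<in> {0..L} \<Longrightarrow> (f t has_vector_derivative fS t S) (at S within {0..L})"
  using assms unfolding C_family.simps by blast

text \<open>The product rule multiplies a derivative by an undifferentiated factor. The former has
  order \<open>n\<close> only, so the latter must be lowered to that order before the induction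
  hypothesis applies.\<close>

lemma C_family_SucD: "C_family (Suc n) T L f \<Longrightarrow> C_family n T L f"
proof (induction n arbitrary: f)
  case (Suc n)
  obtain ft fS where ft: "C_family (Suc n) T L ft" and fS: "C_family (Suc n) T L fS"
    and *: "\<And>t S. t \<in> T \<Longrightarrow> S \<in> {0..L} \<Longrightarrow> ((\<lambda>t'. f t' S) has_vector_derivative ft t S) (at t within T)"
      "\<And>t S. t \<in> T \<Longrightarrow> S \<in> {0..L} \<Longrightarrow> (f t has_vector_derivative fS t S) (at S within {0..L})"
    using C_family_SucE[OF Suc.prems] by blast
  show ?case
    unfolding C_family.simps(2)
    using C_family_continuous[OF Suc.prems] Suc.IH[OF ft] Suc.IH[OF fS] * by blast
qed auto

lemma C_family_cong:
  assumes "C_family n T L f" "\<And>t S. t \<in> T \<Longrightarrow> S \<in> {0..L} \<Longrightarrow> f t S = g t S"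
  shows "C_family n T L g"
proof (cases n)
  case 0
  then show ?thesis
    using assms continuous_on_eq[OF C_family_continuous[OF assms(1)], of "\<lambda>x. g (fst x) (snd x)"]
    by auto
next
  case (Suc m)
  obtain ft fS where *: "C_family m T L ft" "C_family m T L fS"
    and ft: "\<And>t S. t \<in> T \<Longrightarrow> S \<in> {0..L} \<Longrightarrow> ((\<lambda>t'. f t' S) has_vector_derivative ft t S) (at t within T)"
    and fS: "\<And>t S. t \<in> T \<Longrightarrow> S \<in> {0..L} \<Longrightarrow> (f t has_vector_derivative fS t S) (at S within {0..L})"
    using C_family_SucE[OF assms(1)[unfolded Suc]] by blast
  have "continuous_on (Sigma T (\<lambda>_. {0..L})) (\<lambda>x. g (fst x) (snd x))"
    using continuous_on_eq[OF C_family_continuous[OF assms(1)], of "\<lambda>x. g (fst x) (snd x)"]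
      assms(2) by auto
  moreover have "((\<lambda>t'. g t' S) has_vector_derivative ft t S) (at t within T)"
    if "t \<in> T" "S \<in> {0..L}" for t S
    using has_vector_derivative_transform[OF that(1) _ ft[OF that]] assms(2) that by auto
  moreover have "(g t has_vector_derivative fS t S) (at S within {0..L})"
    if "t \<in> T" "S \<in> {0..L}" for t S
    using has_vector_derivative_transform[OF that(2) _ fS[OF that]] assms(2) that by auto
  ultimately show ?thesis
    using * unfolding Suc C_family.simps by blast
qed

section \<open>Closure properties of smoothness of finite order\<close>

lemma C_family_const: "C_family n T L (\<lambda>_ _. c)"
proof (induction n arbitrary: c)
  case (Suc n)
  show ?case
    by (rule C_family_SucI[OF Suc Suc[of 0] Suc[of 0]]) auto
qed auto

lemma C_family_add:
  "C_family n T L f \<Longrightarrow> C_family n T L g \<Longrightarrow> C_family n T L (\<lambda>t S. f t S + g t S)"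
proof (induction n arbitrary: f g)
  case (Suc n)
  obtain ft fS where f: "C_family n T L ft" "C_family n T L fS"
    and f': "\<And>t S. t \<in> T \<Longrightarrow> S \<in> {0..L} \<Longrightarrow> ((\<lambda>t'. f t' S) has_vector_derivative ft t S) (at t within T)"
     "\<And>t S. t \<in> T \<Longrightarrow> S \<in> {0..L} \<Longrightarrow> (f t has_vector_derivative fS t S) (at S within {0..L})"
    using C_family_SucE[OF Suc.prems(1)] by blast
  obtain gt gS where g: "C_family n T L gt" "C_family n T L gS"
    and g': "\<And>t S. t \<in> T \<Longrightarrow> S \<in> {0..L} \<Longrightarrow> ((\<lambda>t'. g t' S) has_vector_derivative gt t S) (at t within T)"
     "\<And>t S. t \<in> T \<Longrightarrow> S \<in> {0..L} \<Longrightarrow> (g t has_vector_derivative gS t S) (at S within {0..L})"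
    using C_family_SucE[OF Suc.prems(2)] by blast
  show ?case
    by (rule C_family_SucI[OF Suc.IH[OF C_family_SucD C_family_SucD, OF Suc.prems]
          Suc.IH[OF f(1) g(1)] Suc.IH[OF f(2) g(2)]])
      (use f' g' in \<open>auto intro!: has_vector_derivative_add\<close>)
qed (auto intro: continuous_intros)

text \<open>One lemma for scaling, inner, matrix and cross products. The partials are again sums of
  values of \<open>b\<close> at other arguments, hence the induction over arbitrary \<open>f\<close>
  and \<open>g\<close>.\<close>

lemma C_family_bilinear:
  assumes "bounded_bilinear b"
  shows "C_family n T L f \<Longrightarrow> C_family n T L g \<Longrightarrow> C_family n T L (\<lambda>t S. b (f t S) (g t S))"
proof (induction n arbitrary: f g)
  case (Suc n)
  obtain ft fS where f: "C_family n T L ft" "C_family n T L fS"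
    and f': "\<And>t S. t \<in> T \<Longrightarrow> S \<in> {0..L} \<Longrightarrow> ((\<lambda>t'. f t' S) has_vector_derivative ft t S) (at t within T)"
     "\<And>t S. t \<in> T \<Longrightarrow> S \<in> {0..L} \<Longrightarrow> (f t has_vector_derivative fS t S) (at S within {0..L})"
    using C_family_SucE[OF Suc.prems(1)] by blast
  obtain gt gS where g: "C_family n T L gt" "C_family n T L gS"
    and g': "\<And>t S. t \<in> T \<Longrightarrow> S \<in> {0..L} \<Longrightarrow> ((\<lambda>t'. g t' S) has_vector_derivative gt t S) (at t within T)"
     "\<And>t S. t \<in> T \<Longrightarrow> S \<in> {0..L} \<Longrightarrow> (g t has_vector_derivative gS t S) (at S within {0..L})"
    using C_family_SucE[OF Suc.prems(2)] by blast
  note fg = C_family_SucD[OF Suc.prems(1)] C_family_SucD[OF Suc.prems(2)]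
  show ?case
    by (rule C_family_SucI[OF Suc.IH[OF fg]
          C_family_add[OF Suc.IH[OF fg(1) g(1)] Suc.IH[OF f(1) fg(2)]]
          C_family_add[OF Suc.IH[OF fg(1) g(2)] Suc.IH[OF f(2) fg(2)]]])
      (use f' g' in \<open>auto intro!: bounded_bilinear.has_vector_derivative[OF assms]\<close>)
qed (auto intro: bounded_bilinear.continuous_on[OF assms])

lemma C_family_linear:
  assumes "bounded_linear h"
  shows "C_family n T L f \<Longrightarrow> C_family n T L (\<lambda>t S. h (f t S))"
proof (induction n arbitrary: f)
  case (Suc n)
  obtain ft fS where f: "C_family n T L ft" "C_family n T L fS"
    and f': "\<And>t S. t \<in> T \<Longrightarrow> S \<in> {0..L} \<Longrightarrow> ((\<lambda>t'. f t' S) has_vector_derivative ft t S) (at t within T)"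
     "\<And>t S. t \<in> T \<Longrightarrow> S \<in> {0..L} \<Longrightarrow> (f t has_vector_derivative fS t S) (at S within {0..L})"
    using C_family_SucE[OF Suc.prems(1)] by blast
  show ?case
    by (rule C_family_SucI[OF Suc.IH[OF C_family_SucD[OF Suc.prems]] Suc.IH[OF f(1)] Suc.IH[OF f(2)]])
      (use f' in \<open>auto intro!: bounded_linear.has_vector_derivative[OF assms]\<close>)
qed (auto intro: bounded_linear.continuous_on[OF assms])

text \<open>The derivative of 1/f is -(1/f) f' (1/f), built from 1/f itself and f'. The induction
  therefore stays with one and the same \<open>f\<close>.\<close>

lemma C_family_inverse:
  fixes f :: "real \<Rightarrow> real \<Rightarrow> real"
  assumes "\<And>t S. t \<in> T \<Longrightarrow> S \<in> {0..L} \<Longrightarrow> f t S \<noteq> 0"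
  shows "C_family n T L f \<Longrightarrow> C_family n T L (\<lambda>t S. inverse (f t S))"
proof (induction n)
  case (Suc n)
  obtain ft fS where f: "C_family n T L ft" "C_family n T L fS"
    and f': "\<And>t S. t \<in> T \<Longrightarrow> S \<in> {0..L} \<Longrightarrow> ((\<lambda>t'. f t' S) has_vector_derivative ft t S) (at t within T)"
     "\<And>t S. t \<in> T \<Longrightarrow> S \<in> {0..L} \<Longrightarrow> (f t has_vector_derivative fS t S) (at S within {0..L})"
    using C_family_SucE[OF Suc.prems(1)] by blast
  note IH = Suc.IH[OF C_family_SucD[OF Suc.prems]]
  have *: "C_family n T L (\<lambda>t S. - (inverse (f t S) * g t S * inverse (f t S)))" if "C_family n T L g" for g
    by (intro C_family_linear[OF bounded_linear_minus[OF bounded_linear_ident]]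
        C_family_bilinear[OF bounded_bilinear_mult] IH that)
  show ?case
    by (rule C_family_SucI[OF IH *[OF f(1)] *[OF f(2)]])
      (use assms f' in \<open>auto simp flip: has_real_derivative_iff_has_vector_derivative
        intro!: DERIV_inverse'\<close>)
qed (use assms in \<open>auto intro!: continuous_on_inverse\<close>)

section \<open>Commuting partial derivatives and the array of all derivatives\<close>

lemma at_within_open_neq_bot:
  assumes "open T" "(t::real) \<in> T"
  shows "at t within T \<noteq> bot"
  using at_within_open[OF assms(2,1)] by simp

lemma at_within_Icc_neq_bot: "0 < L \<Longrightarrow> S \<in> {0..L} \<Longrightarrow> at (S::real) within {0..L} \<noteq> bot"
  by (simp add: trivial_limit_within islimpt_Icc)

lemma continuous_on_section:
  assumes "continuous_on (Sigma T (\<lambda>_. B)) (\<lambda>x. f (fst x) (snd x))" "t \<in> T"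
  shows "continuous_on B (f t)"
proof -
  have "continuous_on B (\<lambda>S. (t, S))"
    by (intro continuous_on_Pair continuous_on_const continuous_on_id)
  from continuous_on_compose2[OF assms(1) this] show ?thesis
    using assms(2) by (simp add: image_subset_iff)
qed

text \<open>Schwarz's theorem in a form that also produces the second mixed derivative.
  Differentiating f(u,x) - f(u,0), the integral of \<open>fS u\<close> over [0,x], under the
  integral sign gives ft(t,x) - ft(t,0) as the integral of \<open>fSt t\<close>; the fundamental
  theorem of calculus does the rest. The argument covers the ends of the interval, where the
  S-derivative is one-sided.\<close>

lemma mixed_partial_derivatives:
  fixes f :: "real \<Rightarrow> real \<Rightarrow> 'a::banach"
  assumes T: "open T" "convex T" and L: "0 < L"
    and ft: "\<And>t S. t \<in> T \<Longrightarrow> S \<in> {0..L} \<Longrightarrow> ((\<lambda>t'. f t' S) has_vector_derivative ft t S) (at t within T)"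
    and fS: "\<And>t S. t \<in> T \<Longrightarrow> S \<in> {0..L} \<Longrightarrow> (f t has_vector_derivative fS t S) (at S within {0..L})"
    and fSt: "\<And>t S. t \<in> T \<Longrightarrow> S \<in> {0..L} \<Longrightarrow> ((\<lambda>t'. fS t' S) has_vector_derivative fSt t S) (at t within T)"
    and contS: "continuous_on (Sigma T (\<lambda>_. {0..L})) (\<lambda>x. fS (fst x) (snd x))"
    and cont: "continuous_on (Sigma T (\<lambda>_. {0..L})) (\<lambda>x. fSt (fst x) (snd x))"
    and t: "t \<in> T" and S: "S \<in> {0..L}"
  shows "(ft t has_vector_derivative fSt t S) (at S within {0..L})"
proof -
  have eq: "ft t x = ft t 0 + integral {0..x} (fSt t)" if x: "x \<in> {0..L}" for x
  proof -
    have *: "integral {0..x} (fS u) = f u x - f u 0" if "u \<in> T" for u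
    proof (rule integral_unique, rule fundamental_theorem_of_calculus)
      show "(f u has_vector_derivative fS u y) (at y within {0..x})" if "y \<in> {0..x}" for y
        by (rule has_vector_derivative_within_subset[OF fS]) (use x that \<open>u \<in> T\<close> in auto)
    qed (use x in simp)
    have "((\<lambda>u. integral (cbox 0 x) (fS u)) has_vector_derivative integral (cbox 0 x) (fSt t)) (at t within T)"
    proof (rule leibniz_rule_vector_derivative)
      show "fS u integrable_on cbox 0 x" if "u \<in> T" for u
        using continuous_on_subset[OF continuous_on_section[OF contS that], of "{0..x}"] x
        by (auto intro!: integrable_continuous_real)
      show "continuous_on (Sigma T (\<lambda>_. cbox 0 x)) (\<lambda>(x, y). fSt x y)"
        unfolding split_beta by (rule continuous_on_subset[OF cont]) (use x in auto)
      show "((\<lambda>u. fS u y) has_vector_derivative fSt u y) (at u within T)"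
        if "u \<in> T" "y \<in> cbox 0 x" for u y
        by (rule fSt) (use x that in auto)
    qed (fact t T)+
    from has_vector_derivative_transform[OF t _ this, of "\<lambda>u. f u x - f u 0"]
    have "((\<lambda>u. f u x - f u 0) has_vector_derivative integral {0..x} (fSt t)) (at t within T)"
      by (simp add: *)
    moreover have "((\<lambda>u. f u x - f u 0) has_vector_derivative ft t x - ft t 0) (at t within T)"
      by (intro has_vector_derivative_diff ft) (use t x L in auto)
    ultimately have "integral {0..x} (fSt t) = ft t x - ft t 0"
      by (intro vector_derivative_unique_within[OF at_within_open_neq_bot[OF T(1) t]])
    then show ?thesis by simp
  qed
  have "((\<lambda>x. ft t 0 + integral {0..x} (fSt t)) has_vector_derivative 0 + fSt t S) (at S within {0..L})"
    by (intro has_vector_derivative_add has_vector_derivative_const integral_has_vector_derivative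
        continuous_on_section[OF cont t] S)
  then show ?thesis
    using has_vector_derivative_transform[OF S eq] by simp
qed

text \<open>The array is D i j = dt^i dx^j f. Its rule in t then holds by construction, while the
  rule in S requires \<open>dx\<close> to pass through i derivatives in t, which is
  \<open>dxi\<close>.\<close>

lemma C_family_imp_smooth_family:
  fixes f :: "real \<Rightarrow> real \<Rightarrow> 'a::banach"
  assumes T: "open T" "convex T" and L: "0 < L" and f: "\<And>n. C_family n T L f"
  shows "smooth_family T L f"
proof -
  define dt :: "(real \<Rightarrow> real \<Rightarrow> 'a) \<Rightarrow> real \<Rightarrow> real \<Rightarrow> 'a" where
    "dt = (\<lambda>g t S. vector_derivative (\<lambda>t'. g t' S) (at t within T))"
  define dx :: "(real \<Rightarrow> real \<Rightarrow> 'a) \<Rightarrow> real \<Rightarrow> real \<Rightarrow> 'a" where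
    "dx = (\<lambda>g t S. vector_derivative (g t) (at S within {0..L}))"
  let ?C = "\<lambda>g. \<forall>n. C_family n T L g"
  have dt: "((\<lambda>t'. g t' S) has_vector_derivative dt g t S) (at t within T)"
    and dx: "(g t has_vector_derivative dx g t S) (at S within {0..L})"
    if g: "?C g" and tS: "t \<in> T" "S \<in> {0..L}" for g t S
  proof -
    obtain gt gS where "C_family 0 T L gt" "C_family 0 T L gS"
      and *: "\<And>t S. t \<in> T \<Longrightarrow> S \<in> {0..L} \<Longrightarrow> ((\<lambda>t'. g t' S) has_vector_derivative gt t S) (at t within T)"
      "\<And>t S. t \<in> T \<Longrightarrow> S \<in> {0..L} \<Longrightarrow> (g t has_vector_derivative gS t S) (at S within {0..L})"
      using C_family_SucE[OF g[rule_format, of "Suc 0"]] by blast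
    from *[OF tS]
    show "((\<lambda>t'. g t' S) has_vector_derivative dt g t S) (at t within T)"
      "(g t has_vector_derivative dx g t S) (at S within {0..L})"
      unfolding dt_def dx_def using vector_derivative_works differentiableI_vector by blast+
  qed
  \<comment> \<open>The partials supplied at different orders could be different functions.
    Uniqueness of derivatives identifies all of them on the region with \<open>dt g\<close> and
    \<open>dx g\<close>, which thus inherit every order.\<close>
  have C: "?C (dt g)" "?C (dx g)" if g: "?C g" for g
  proof -
    have "C_family n T L (dt g) \<and> C_family n T L (dx g)" for n
    proof -
      obtain gt gS where n: "C_family n T L gt" "C_family n T L gS" and
        gt: "\<And>t S. t \<in> T \<Longrightarrow> S \<in> {0..L} \<Longrightarrow> ((\<lambda>t'. g t' S) has_vector_derivative gt t S) (at t within T)" and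
        gS: "\<And>t S. t \<in> T \<Longrightarrow> S \<in> {0..L} \<Longrightarrow> (g t has_vector_derivative gS t S) (at S within {0..L})"
        using C_family_SucE[OF g[rule_format, of "Suc n"]] by blast
      have "dt g t S = gt t S" "dx g t S = gS t S" if "t \<in> T" "S \<in> {0..L}" for t S
        unfolding dt_def dx_def
        by (rule vector_derivative_within[OF at_within_open_neq_bot[OF T(1)] gt] that
            vector_derivative_within[OF at_within_Icc_neq_bot[OF L] gS])+
      then show ?thesis
        using C_family_cong[OF n(1), of "dt g"] C_family_cong[OF n(2), of "dx g"] by simp
    qed
    then show "?C (dt g)" "?C (dx g)" by auto
  qed
  have Cij: "?C ((dt ^^ i) ((dx ^^ j) f))" for i j
  proof (induction i)
    case 0
    then show ?case by (induction j) (use f C in auto)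
  qed (use C in auto)
  have commute: "(dt g t has_vector_derivative dt (dx g) t S) (at S within {0..L})"
    if g: "?C g" "t \<in> T" "S \<in> {0..L}" for g t S
    using C(2)[OF g(1)] C(1)[OF C(2)[OF g(1)]]
    by (intro mixed_partial_derivatives[OF T L dt[OF g(1)] dx[OF g(1)] dt[OF C(2)[OF g(1)]]
          _ _ g(2,3)] C_family_continuous) blast+
  have dxi: "((dt ^^ i) g t has_vector_derivative (dt ^^ i) (dx g) t S) (at S within {0..L})"
    if g: "?C g" and tS: "t \<in> T" "S \<in> {0..L}" for g t S i
    using tS
  proof (induction i arbitrary: t S)
    case 0
    then show ?case using dx[OF g] by auto
  next
    case (Suc i)
    have i: "?C ((dt ^^ i) g)" for i
      by (induction i) (use g C in auto)
    have *: "dx ((dt ^^ i) g) t S = (dt ^^ i) (dx g) t S" if "t \<in> T" "S \<in> {0..L}" for t S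
      using vector_derivative_within[OF at_within_Icc_neq_bot[OF L that(2)] Suc.IH[OF that]]
      by (simp add: dx_def[THEN fun_cong, of "(dt ^^ i) g"])
    have "((\<lambda>u. (dt ^^ i) (dx g) u S) has_vector_derivative dt (dx ((dt ^^ i) g)) t S) (at t within T)"
      using Suc.prems
      by (intro has_vector_derivative_transform[OF Suc.prems(1) _ dt[OF C(2)[OF i] Suc.prems]])
        (simp add: *)
    then have "dt (dx ((dt ^^ i) g)) t S = dt ((dt ^^ i) (dx g)) t S"
      using vector_derivative_within[OF at_within_open_neq_bot[OF T(1) Suc.prems(1)], symmetric]
      by (simp add: dt_def[THEN fun_cong, of "(dt ^^ i) (dx g)"])
    then show ?case
      using commute[OF i[of i] Suc.prems] by simp
  qed
  define D where "D = (\<lambda>i j. (dt ^^ i) ((dx ^^ j) f))"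
  have "continuous_on (Sigma T (\<lambda>_. {0..L})) (\<lambda>x. D i j (fst x) (snd x))" for i j
    unfolding D_def using Cij C_family_continuous by blast
  moreover have "((\<lambda>t'. D i j t' S) has_vector_derivative D (Suc i) j t S) (at t within T)"
    if "t \<in> T" "S \<in> {0..L}" for i j t S
    unfolding D_def using dt[OF Cij that] by simp
  moreover have "(D i j t has_vector_derivative D i (Suc j) t S) (at S within {0..L})"
    if "t \<in> T" "S \<in> {0..L}" for i j t S
    unfolding D_def using dxi[OF _ that, of "(dx ^^ j) f" i] Cij[of 0 j] by simp
  moreover have "D 0 0 = f"
    unfolding D_def by simp
  ultimately show ?thesis
    unfolding smooth_family_def by (intro exI[of _ D]) auto
qed

section \<open>Smooth fields as families constant in the parameter\<close>

text \<open>A field has parameter derivative 0, so the closure properties of fields are those of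
  families and need no second induction.\<close>

lemma smooth_field_imp_C_family:
  assumes "smooth_field L f"
  shows "C_family n T L (\<lambda>_. f)"
proof -
  obtain D where D: "D (0::nat) = f"
    and *: "\<And>k S. S \<in> {0..L} \<Longrightarrow> (D k has_vector_derivative D (Suc k) S) (at S within {0..L})"
    using assms unfolding smooth_field_def by blast
  have cont: "continuous_on {0..L} (D k)" for k
    using * has_vector_derivative_continuous unfolding continuous_on_eq_continuous_within by blast
  have "C_family n T L (\<lambda>_. D k)" for k
  proof (induction n arbitrary: k)
    case 0
    show ?case
      by (auto intro!: continuous_on_compose2[OF cont] continuous_intros)
  next
    case (Suc n)
    show ?case
      by (rule C_family_SucI[OF Suc C_family_const[of _ _ _ 0] Suc[of "Suc k"]]) (use * in auto)
  qed
  then show ?thesis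
    unfolding D[symmetric] .
qed

lemma smooth_family_imp_smooth_field:
  assumes "smooth_family T L f" "t \<in> T"
  shows "smooth_field L (f t)"
proof -
  obtain D where D: "D (0::nat) (0::nat) = f"
    and *: "\<And>i j t S. t \<in> T \<Longrightarrow> S \<in> {0..L} \<Longrightarrow>
           (D i j t has_vector_derivative D i (Suc j) t S) (at S within {0..L})"
    using assms unfolding smooth_family_def by blast
  show ?thesis
    unfolding smooth_field_def using D * assms(2) by (intro exI[of _ "\<lambda>j. D 0 j t"]) auto
qed

lemma C_family_imp_smooth_field:
  fixes f :: "real \<Rightarrow> 'a::banach"
  assumes "0 < L" "\<And>n. C_family n UNIV L (\<lambda>_. f)"
  shows "smooth_field L f"
  using smooth_family_imp_smooth_field[OF C_family_imp_smooth_family[OF open_UNIV convex_UNIV assms]]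
  by simp

lemma smooth_field_continuous: "smooth_field L f \<Longrightarrow> continuous_on {0..L} f"
  using smooth_field_imp_C_family[of L f 0 UNIV]
  by (auto dest: continuous_on_section[where t = 0])

lemma smooth_field_dS:
  assumes "0 < L" "smooth_field L f"
  shows "S \<in> {0..L} \<Longrightarrow> (f has_vector_derivative dS L f S) (at S within {0..L})"
    and "smooth_field L (dS L f)"
proof -
  obtain D where D: "D (0::nat) = f"
    and *: "\<And>k S. S \<in> {0..L} \<Longrightarrow> (D k has_vector_derivative D (Suc k) S) (at S within {0..L})"
    using assms unfolding smooth_field_def by blast
  have eq: "dS L f S = D 1 S" if "S \<in> {0..L}" for S
    unfolding dS_def D[symmetric] using *[of S 0] that assms(1)
    by (intro vector_derivative_within at_within_Icc_neq_bot) auto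
  show "(f has_vector_derivative dS L f S) (at S within {0..L})" if "S \<in> {0..L}"
    using *[OF that, of 0] eq[OF that] by (simp add: D)
  have "(dS L f has_vector_derivative D 2 S) (at S within {0..L})" if "S \<in> {0..L}" for S
    using has_vector_derivative_transform[OF that eq *[OF that, of 1]] by (simp add: numeral_2_eq_2)
  \<comment> \<open>\<open>dS L f\<close> and \<open>D 1\<close> agree on [0, L] only, whereas
    \<open>smooth_field\<close> wants the zeroth entry equal as a function. So the shifted sequence
    keeps all entries but that one.\<close>
  then have "\<forall>k. \<forall>S\<in>{0..L}. ((case k of 0 \<Rightarrow> dS L f | Suc m \<Rightarrow> D (Suc (Suc m))) has_vector_derivative
      D (Suc (Suc k)) S) (at S within {0..L})"
    using * by (auto split: nat.split simp: numeral_2_eq_2)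
  then show "smooth_field L (dS L f)"
    unfolding smooth_field_def
    by (intro exI[of _ "\<lambda>k. case k of 0 \<Rightarrow> dS L f | Suc m \<Rightarrow> D (Suc (Suc m))"]) simp
qed

lemma dS_eqI:
  assumes "0 < L" "S \<in> {0..L}" "(f has_vector_derivative f') (at S within {0..L})"
  shows "dS L f S = f'"
  unfolding dS_def using assms by (intro vector_derivative_within at_within_Icc_neq_bot)

context
  fixes L :: real
  assumes L: "0 < L"
begin

lemma smooth_field_const: "smooth_field L (\<lambda>_. c::'a::banach)"
  by (rule C_family_imp_smooth_field[OF L C_family_const])

lemma smooth_field_cong:
  fixes f g :: "real \<Rightarrow> 'a::banach"
  assumes "smooth_field L f" "\<And>S. S \<in> {0..L} \<Longrightarrow> f S = g S"
  shows "smooth_field L g"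
  by (rule C_family_imp_smooth_field[OF L], rule C_family_cong, rule smooth_field_imp_C_family, fact)
    (use assms in auto)

lemma smooth_field_add:
  fixes f g :: "real \<Rightarrow> 'a::banach"
  assumes "smooth_field L f" "smooth_field L g"
  shows "smooth_field L (\<lambda>S. f S + g S)"
  by (rule C_family_imp_smooth_field[OF L C_family_add[OF assms[THEN smooth_field_imp_C_family]]])

lemma smooth_field_linear:
  fixes h :: "'a::real_normed_vector \<Rightarrow> 'b::banach"
  assumes "bounded_linear h" "smooth_field L f"
  shows "smooth_field L (\<lambda>S. h (f S))"
  by (rule C_family_imp_smooth_field[OF L
        C_family_linear[OF assms(1) smooth_field_imp_C_family[OF assms(2)]]])

lemma smooth_field_bilinear:
  fixes b :: "'a::real_normed_vector \<Rightarrow> 'b::real_normed_vector \<Rightarrow> 'c::banach"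
  assumes "bounded_bilinear b" "smooth_field L f" "smooth_field L g"
  shows "smooth_field L (\<lambda>S. b (f S) (g S))"
  by (rule C_family_imp_smooth_field[OF L
        C_family_bilinear[OF assms(1) assms(2,3)[THEN smooth_field_imp_C_family]]])

lemma smooth_field_minus:
  fixes f :: "real \<Rightarrow> 'a::banach"
  shows "smooth_field L f \<Longrightarrow> smooth_field L (\<lambda>S. - f S)"
  by (rule smooth_field_linear[OF bounded_linear_minus[OF bounded_linear_ident]])

lemma smooth_field_diff:
  fixes f g :: "real \<Rightarrow> 'a::banach"
  assumes "smooth_field L f" "smooth_field L g"
  shows "smooth_field L (\<lambda>S. f S - g S)"
  using smooth_field_add[OF assms(1) smooth_field_minus[OF assms(2)]] by simp

lemma smooth_field_ident: "smooth_field L (\<lambda>S. S)"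
proof -
  have "\<forall>k. \<forall>S\<in>{0..L}. ((\<lambda>S. if k = 0 then S else if k = 1 then 1 else (0::real)) has_vector_derivative
      (if Suc k = 0 then S else if Suc k = 1 then 1 else 0)) (at S within {0..L})"
    by (auto intro!: derivative_eq_intros)
  then show ?thesis
    unfolding smooth_field_def
    by (intro exI[of _ "\<lambda>k S. if k = 0 then S else if k = 1 then 1 else 0"]) auto
qed

end

section \<open>Skew matrices and rotations\<close>

lemma bounded_bilinear_matrix_vector_mult:
  "bounded_bilinear ((*v) :: real^'n^'m \<Rightarrow> real^'n \<Rightarrow> real^'m)"
  unfolding bilinear_conv_bounded_bilinear[symmetric] bilinear_def
  by (auto intro!: linearI simp: matrix_vector_mult_def vec_eq_iff sum.distrib sum_distrib_left
      algebra_simps)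

lemma bounded_bilinear_matrix_matrix_mult:
  "bounded_bilinear ((**) :: real^'n^'m \<Rightarrow> real^'k^'n \<Rightarrow> real^'k^'m)"
  unfolding bilinear_conv_bounded_bilinear[symmetric] bilinear_def
  by (auto intro!: linearI simp: matrix_matrix_mult_def vec_eq_iff sum.distrib sum_distrib_left
      algebra_simps)

lemma bounded_bilinear_cross3: "bounded_bilinear cross3"
  unfolding bilinear_conv_bounded_bilinear[symmetric] by (rule bilinear_cross)

lemma bounded_linear_transpose: "bounded_linear (transpose :: real^'n^'m \<Rightarrow> real^'m^'n)"
  unfolding linear_conv_bounded_linear[symmetric]
  by (auto intro!: linearI simp: transpose_def vec_eq_iff)

lemma jinv_nth:
  "jinv a $ 1 $ 1 = 0" "jinv a $ 1 $ 2 = - a $ 3" "jinv a $ 1 $ 3 = a $ 2"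
  "jinv a $ 2 $ 1 = a $ 3" "jinv a $ 2 $ 2 = 0" "jinv a $ 2 $ 3 = - a $ 1"
  "jinv a $ 3 $ 1 = - a $ 2" "jinv a $ 3 $ 2 = a $ 1" "jinv a $ 3 $ 3 = 0"
  by (simp_all add: jinv_def matrix_def cross3_def axis_def)

lemma jinv_vector [simp]: "jinv a *v x = cross3 a x"
  by (simp add: vec_eq_iff forall_3 matrix_vector_mult_def sum_3 jinv_nth cross3_def)

lemma bounded_linear_jinv: "bounded_linear jinv"
  unfolding linear_conv_bounded_linear[symmetric]
  by (auto intro!: linearI simp: vec_eq_iff forall_3 jinv_nth)

lemma skew_jinv: "skew (jinv a)"
  unfolding skew_def by (simp add: vec_eq_iff forall_3 jinv_nth transpose_def)

text \<open>The axial vector of the skew part of a matrix. It agrees with \<open>jmap\<close> on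
  skew matrices, but is linear on all matrices, so smoothness passes through it; \<open>jmap\<close>
  is a definite description that means something only in the skew case.\<close>

definition axial :: "real^3^3 \<Rightarrow> real^3" where
  "axial A = (1/2) *\<^sub>R vector [A $ 3 $ 2 - A $ 2 $ 3, A $ 1 $ 3 - A $ 3 $ 1, A $ 2 $ 1 - A $ 1 $ 2]"

lemma axial_nth:
  "axial A $ 1 = (A $ 3 $ 2 - A $ 2 $ 3) / 2" "axial A $ 2 = (A $ 1 $ 3 - A $ 3 $ 1) / 2"
  "axial A $ 3 = (A $ 2 $ 1 - A $ 1 $ 2) / 2"
  by (simp_all add: axial_def)

lemma bounded_linear_axial: "bounded_linear axial"
  unfolding linear_conv_bounded_linear[symmetric]
  by (auto intro!: linearI simp: vec_eq_iff forall_3 axial_nth field_simps)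

lemma axial_jinv [simp]: "axial (jinv a) = a"
  by (simp add: vec_eq_iff forall_3 axial_nth jinv_nth)

lemma jinv_axial:
  assumes "skew A"
  shows "jinv (axial A) = A"
proof -
  have *: "A $ j $ i = - A $ i $ j" for i j
    using arg_cong[OF assms[unfolded skew_def], of "\<lambda>B. B $ i $ j"] by (simp add: transpose_def)
  show ?thesis
    using *[of 1 1] *[of 2 2] *[of 3 3] *[of 2 1] *[of 3 1] *[of 3 2]
    by (simp add: vec_eq_iff forall_3 axial_nth jinv_nth)
qed

lemma jmap_jinv [simp]: "jmap (jinv a) = a"
  unfolding jmap_def
proof (rule the_equality)
  show "b = a" if "\<forall>x. jinv a *v x = cross3 b x" for b
  proof -
    have "jinv a = jinv b"
      using that by (simp add: matrix_eq)
    then show ?thesis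
      by (metis axial_jinv)
  qed
qed simp

lemma jmap_eq_axial: "skew A \<Longrightarrow> jmap A = axial A"
  by (metis jinv_axial jmap_jinv)

lemma jinv_jmap: "skew A \<Longrightarrow> jinv (jmap A) = A"
  by (simp add: jmap_eq_axial jinv_axial)

text \<open>The Lie algebra so(3) is R^3 with the cross product. This is the source of the term K x
  w in the variation of the curvature.\<close>

lemma axial_commutator: "axial (jinv a ** jinv b - jinv b ** jinv a) = cross3 a b"
  by (simp add: vec_eq_iff forall_3 axial_nth jinv_nth matrix_matrix_mult_def sum_3 cross3_def)

declare transpose_matrix_vector [simp del]

lemma matrix_inv_eqI:
  fixes A B :: "real^'n^'n"
  assumes "A ** B = mat 1" "B ** A = mat 1"
  shows "matrix_inv A = B"
proof -
  have "matrix_inv A ** A = mat 1"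
    unfolding matrix_inv_def by (rule someI2[of _ B]) (use assms in auto)
  then have "matrix_inv A ** (A ** B) = B"
    by (simp add: matrix_mul_assoc)
  then show ?thesis
    by (simp add: assms)
qed

lemma matrix_inv_rotation: "rotation_matrix (Q :: real^3^3) \<Longrightarrow> matrix_inv Q = transpose Q"
  by (rule matrix_inv_eqI) (simp_all add: orthogonal_matrix_def rotation_matrix_def)

lemma rotation_transpose_mult:
  assumes "rotation_matrix (Q :: real^3^3)"
  shows "transpose Q ** Q = mat 1" "Q ** transpose Q = mat 1"
  using assms by (auto simp: rotation_matrix_def orthogonal_matrix_def)

lemma rotation_cancel [simp]:
  assumes "rotation_matrix (Q :: real^3^3)"
  shows "transpose Q *v (Q *v x) = x" "Q *v (transpose Q *v x) = x"
    "transpose Q ** (Q ** A) = A" "Q ** (transpose Q ** A) = A"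
  using rotation_transpose_mult[OF assms]
  by (simp_all add: matrix_vector_mul_assoc matrix_mul_assoc)

lemma mat_pairing_rotation:
  assumes "rotation_matrix Q"
  shows "mat_pairing (Q ** A) (Q ** B) = mat_pairing A B"
  using assms by (simp add: mat_pairing_def matrix_transpose_mul matrix_mul_assoc[symmetric])

text \<open>Each component occurs twice in a skew matrix; the factor 1/2 of
  \<open>mat_pairing\<close> makes \<open>jinv\<close> an isometry.\<close>

lemma mat_pairing_jinv: "mat_pairing (jinv a) (jinv b) = a \<bullet> b"
  by (simp add: mat_pairing_def trace_def matrix_matrix_mult_def transpose_def sum_3 jinv_nth inner_vec_def)

lemma tangent_SO3_eq:
  assumes "rotation_matrix Q" "M \<in> tangent_SO3 Q"
  shows "M = Q ** jinv (jmap (transpose Q ** M))"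
  using assms by (auto simp: tangent_SO3_def jinv_jmap)

lemma tangent_SO3_jinv: "Q ** jinv a \<in> tangent_SO3 Q"
  unfolding tangent_SO3_def using skew_jinv by blast

section \<open>The Cayley transform\<close>

text \<open>For A = \<open>jinv a\<close> this is (1 + A)(1 - A)^-1, expanded by means of A^3 =
  -|a|^2 A. To first order it is 1 + 2 A.\<close>

definition cayley :: "real^3 \<Rightarrow> real^3^3" where
  "cayley a = mat 1 + (2 * inverse (1 + a \<bullet> a)) *\<^sub>R (jinv a + jinv a ** jinv a)"

lemma rotation_cayley: "rotation_matrix (cayley a)"
proof -
  define c where "c = 2 * inverse (1 + a \<bullet> a)"
  have "1 + a \<bullet> a > 0" by (smt (verit) inner_ge_zero)
  then have c: "c * (1 + (a $ 1 * a $ 1 + a $ 2 * a $ 2 + a $ 3 * a $ 3)) = 2"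
    unfolding c_def by (simp add: inner_vec_def sum_3)
  \<comment> \<open>The defect of the relation between \<open>c\<close> and \<open>a\<close>. With
    \<open>e\<close> kept in place, both matrix identities below are polynomial identities in
    \<open>c\<close> and the entries of \<open>a\<close>; setting e = 0 comes afterwards.\<close>
  define e where "e = c * (1 + (a $ 1 * a $ 1 + a $ 2 * a $ 2 + a $ 3 * a $ 3)) - 2"
  have e: "e = 0" unfolding e_def using c by simp
  have nth: "cayley a $ i $ j = mat 1 $ i $ j + c * (jinv a $ i $ j + (\<Sum>k\<in>UNIV. jinv a $ i $ k * jinv a $ k $ j))" for i j
    unfolding cayley_def c_def[symmetric] by (simp add: matrix_matrix_mult_def)
  have "transpose (cayley a) ** cayley a = mat 1 - (e * c) *\<^sub>R (jinv a ** jinv a)"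
    unfolding e_def
    by (simp add: vec_eq_iff forall_3 transpose_def matrix_matrix_mult_def nth sum_3 jinv_nth mat_def)
      (simp add: algebra_simps)
  then have *: "transpose (cayley a) ** cayley a = mat 1"
    by (simp add: e)
  then have "cayley a ** transpose (cayley a) = mat 1"
    by (simp add: matrix_left_right_inverse)
  \<comment> \<open>Orthogonality leaves the sign of the determinant open. The defining relation of
    the Cayley transform settles it, as 1 + A and 1 - A have the same positive determinant.\<close>
  have "cayley a ** (mat 1 - jinv a) = mat 1 + jinv a + e *\<^sub>R jinv a"
    unfolding e_def
    by (simp add: vec_eq_iff forall_3 matrix_matrix_mult_def nth sum_3 jinv_nth mat_def)
      (simp add: algebra_simps)
  then have "det (cayley a) * det (mat 1 - jinv a) = det (mat 1 + jinv a)"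
    by (simp add: e flip: det_mul)
  moreover have "det (mat 1 - jinv a) = 1 + a \<bullet> a" "det (mat 1 + jinv a) = 1 + a \<bullet> a"
    by (simp_all add: det_3 jinv_nth mat_def inner_vec_def sum_3 algebra_simps)
  ultimately have "det (cayley a) = 1"
    using \<open>1 + a \<bullet> a > 0\<close> by simp
  with * \<open>cayley a ** transpose (cayley a) = mat 1\<close> show ?thesis
    by (simp add: rotation_matrix_def orthogonal_matrix_def)
qed

lemma inner_matrix_vector: "x \<bullet> (A *v y) = (transpose A *v x) \<bullet> (y :: real^'n)"
  by (simp add: dot_lmul_matrix transpose_matrix_vector)

section \<open>Tensors and derivatives in a moving frame\<close>

lemma tensor_rotation:
  "rotation_matrix Q \<Longrightarrow> tensor X Q u = Q *v (X *v (transpose Q *v u))"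
  by (simp add: tensor_def bold_def comps_def matrix_inv_rotation)

lemma bounded_linear_tensor: "bounded_linear (tensor X Q)"
  unfolding tensor_def bold_def comps_def
  by (intro bounded_linear_compose[OF matrix_vector_mul_bounded_linear]
      bounded_linear_compose[OF matrix_vector_mul_bounded_linear bounded_linear_compose[OF matrix_vector_mul_bounded_linear]]
      matrix_vector_mul_bounded_linear)

lemma inner_tensor:
  assumes "rotation_matrix Q"
  shows "u \<bullet> tensor X Q v = (transpose Q *v u) \<bullet> (X *v (transpose Q *v v))"
  by (simp add: tensor_rotation[OF assms] inner_matrix_vector)

lemma inner_tensor_commute:
  assumes "rotation_matrix Q" "transpose X = X"
  shows "u \<bullet> tensor X Q v = tensor X Q u \<bullet> v"
  unfolding inner_commute[of "tensor X Q u"] inner_tensor[OF assms(1)]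
  by (subst inner_matrix_vector) (simp add: assms(2) inner_commute)

text \<open>For symmetric \<open>X\<close> the two cross terms coincide. The resulting factor 2 is
  cancelled by the 1/2 in the Hamiltonian, so \<open>tensor X Q u\<close> itself becomes the
  gradient.\<close>

lemma inner_tensor_quadratic:
  assumes "rotation_matrix Q" "transpose X = X"
  shows "(u + s *\<^sub>R v) \<bullet> tensor X Q (u + s *\<^sub>R v) =
    u \<bullet> tensor X Q u + s * (2 * (tensor X Q u \<bullet> v)) + s\<^sup>2 * (v \<bullet> tensor X Q v)"
proof -
  interpret bounded_linear "tensor X Q" by (rule bounded_linear_tensor)
  show ?thesis
    using inner_tensor_commute[OF assms, of u v]
    by (simp add: add scaleR inner_add_left inner_add_right inner_commute[of v "tensor X Q u"]
        algebra_simps power2_eq_square)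
qed

text \<open>Differentiate \<open>transpose (Q y) ** Q y = mat 1\<close>. The derivative is taken
  within a set so that the ends of [0, L] are included.\<close>

lemma skew_rotation_derivative:
  assumes Q: "(Q has_vector_derivative Q') (at x within A)" and "at x within A \<noteq> bot"
    and x: "x \<in> A" and rot: "\<And>y. y \<in> A \<Longrightarrow> rotation_matrix (Q y :: real^3^3)"
  shows "skew (transpose (Q x) ** Q')"
proof -
  have "((\<lambda>y. transpose (Q y) ** Q y) has_vector_derivative
      transpose (Q x) ** Q' + transpose Q' ** Q x) (at x within A)"
    by (intro bounded_bilinear.has_vector_derivative[OF bounded_bilinear_matrix_matrix_mult]
        bounded_linear.has_vector_derivative[OF bounded_linear_transpose] Q)
  moreover have "((\<lambda>y. transpose (Q y) ** Q y) has_vector_derivative 0) (at x within A)"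
    by (rule has_vector_derivative_transform[OF x _ has_vector_derivative_const[of "mat 1"]])
      (simp add: rot rotation_transpose_mult)
  ultimately have "transpose (Q x) ** Q' + transpose Q' ** Q x = 0"
    using vector_derivative_unique_within[OF assms(2)] by blast
  then show ?thesis
    by (simp add: skew_def matrix_transpose_mul eq_neg_iff_add_eq_0 add.commute)
qed

section \<open>Calculus of variations on an interval\<close>

text \<open>The assumption at the ends concerns only the product, as in the boundary conditions of
  the theorem: an end may be clamped, free, or a mixture of both.\<close>

lemma integration_by_parts_inner:
  fixes m \<delta> :: vfield
  assumes L: "0 < L" and m: "smooth_field L m" and \<delta>: "smooth_field L \<delta>"
    and bc: "\<And>S. S \<in> {0, L} \<Longrightarrow> \<delta> S \<bullet> m S = 0"
  shows "integral {0..L} (\<lambda>S. m S \<bullet> dS L \<delta> S) = - integral {0..L} (\<lambda>S. dS L m S \<bullet> \<delta> S)"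
proof -
  have "((\<lambda>S. m S \<bullet> dS L \<delta> S + dS L m S \<bullet> \<delta> S) has_integral m L \<bullet> \<delta> L - m 0 \<bullet> \<delta> 0) {0..L}"
    by (rule fundamental_theorem_of_calculus)
      (use L smooth_field_dS(1)[OF L m] smooth_field_dS(1)[OF L \<delta>] in
        \<open>auto intro!: bounded_bilinear.has_vector_derivative[OF bounded_bilinear_inner]\<close>)
  then have "integral {0..L} (\<lambda>S. m S \<bullet> dS L \<delta> S + dS L m S \<bullet> \<delta> S) = 0"
    using bc[of 0] bc[of L] by (simp add: integral_unique inner_commute)
  moreover have "integral {0..L} (\<lambda>S. m S \<bullet> dS L \<delta> S + dS L m S \<bullet> \<delta> S) =
      integral {0..L} (\<lambda>S. m S \<bullet> dS L \<delta> S) + integral {0..L} (\<lambda>S. dS L m S \<bullet> \<delta> S)"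
    by (intro integral_add integrable_continuous_real smooth_field_continuous
        smooth_field_bilinear[OF L bounded_bilinear_inner] smooth_field_dS L m \<delta>)
  ultimately show ?thesis by simp
qed

text \<open>No bump functions are needed: \<open>S (L - S) (g - h)\<close> is itself an admissible test field.\<close>

lemma fundamental_lemma_variations:
  fixes g h :: vfield
  assumes L: "0 < L" and g: "smooth_field L g" and h: "smooth_field L h"
    and eq: "\<And>\<delta>. smooth_field L \<delta> \<Longrightarrow> \<delta> 0 = 0 \<Longrightarrow> \<delta> L = 0 \<Longrightarrow>
      integral {0..L} (\<lambda>S. g S \<bullet> \<delta> S) = integral {0..L} (\<lambda>S. h S \<bullet> \<delta> S)"
    and S: "S \<in> {0..L}"
  shows "g S = h S"
proof -
  define d where "d = (\<lambda>S. g S - h S)"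
  define \<delta> where "\<delta> = (\<lambda>S. (S * (L - S)) *\<^sub>R d S)"
  have d: "smooth_field L d"
    unfolding d_def by (intro smooth_field_diff L g h)
  have \<delta>: "smooth_field L \<delta>"
    unfolding \<delta>_def
    by (intro smooth_field_bilinear[OF L bounded_bilinear_scaleR] d
        smooth_field_bilinear[OF L bounded_bilinear_mult] smooth_field_ident
        smooth_field_diff smooth_field_const L)
  have int: "(\<lambda>S. f S \<bullet> \<delta> S) integrable_on {0..L}" if "smooth_field L f" for f
    by (intro integrable_continuous_real smooth_field_continuous
        smooth_field_bilinear[OF L bounded_bilinear_inner] that \<delta>)
  have cont: "continuous_on {0..L} (\<lambda>S. d S \<bullet> \<delta> S)"
    by (intro smooth_field_continuous smooth_field_bilinear[OF L bounded_bilinear_inner] d \<delta>)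
  have "integral {0..L} (\<lambda>S. d S \<bullet> \<delta> S) = 0"
  proof -
    have "(\<lambda>S. d S \<bullet> \<delta> S) = (\<lambda>S. g S \<bullet> \<delta> S - h S \<bullet> \<delta> S)"
      by (simp add: d_def inner_diff_left)
    moreover have "\<delta> 0 = 0" "\<delta> L = 0"
      by (simp_all add: \<delta>_def)
    ultimately show ?thesis
      using eq[OF \<delta>] integral_diff[OF int[OF g] int[OF h]] by simp
  qed
  moreover have "d S \<bullet> \<delta> S \<ge> 0" if "S \<in> {0..L}" for S
    using that by (simp add: \<delta>_def)
  ultimately have zero: "d S \<bullet> \<delta> S = 0" if "S \<in> {0..L}" for S
    using integral_eq_0_iff[OF cont L] that by blast
  have "d S = 0" if "S \<in> {0<..<L}" for S
    using zero[of S] that by (simp add: \<delta>_def)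
  \<comment> \<open>The weight S (L - S) vanishes at the two ends, so equality there comes from the
    interior by continuity.\<close>
  moreover have clo: "closure {0<..<L} = {0..L}"
    using L by simp
  ultimately have "d S = 0"
    using continuous_constant_on_closure[of "{0<..<L}" d 0 S, unfolded clo]
      smooth_field_continuous[OF d] S by blast
  then show ?thesis
    by (simp add: d_def)
qed

text \<open>The integrand is a polynomial in \<open>s\<close> with continuous coefficients, hence so
  is the integral, and its linear coefficient is read off without differentiating under the integral
  sign.\<close>

lemma has_derivative_integral_quadratic:
  fixes f :: "real \<Rightarrow> real \<Rightarrow> real"
  assumes "continuous_on {0..L} a" "continuous_on {0..L} b" "continuous_on {0..L} c"
    and f: "\<And>s S. S \<in> {0..L} \<Longrightarrow> f s S = a S + s * (2 * b S) + s\<^sup>2 * c S"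
  shows "((\<lambda>s. 1/2 * integral {0..L} (f s)) has_real_derivative integral {0..L} b) (at 0)"
proof -
  note int = assms(1-3)[THEN integrable_continuous_real]
  have "1/2 * integral {0..L} (f s) =
      1/2 * integral {0..L} a + s * integral {0..L} b + s\<^sup>2 * (1/2 * integral {0..L} c)" for s
  proof -
    have "integral {0..L} (f s) = integral {0..L} (\<lambda>S. a S + (2 * s) * b S + s\<^sup>2 * c S)"
      using f by (intro integral_cong) (simp add: algebra_simps)
    also have "\<dots> = integral {0..L} a + (2 * s) * integral {0..L} b + s\<^sup>2 * integral {0..L} c"
      by (intro integral_unique has_integral_add has_integral_mult_right integrable_integral int)
    finally show ?thesis by (simp add: algebra_simps)
  qed
  then show ?thesis
    by (auto intro!: derivative_eq_intros)
qed

lemma curvature_rotation: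
  assumes L: "0 < L" and S: "S \<in> {0..L}"
    and Q: "(Q has_vector_derivative Q') (at S within {0..L})"
    and rot: "\<And>S. S \<in> {0..L} \<Longrightarrow> rotation_matrix (Q S)"
  shows "curvature L Q S = Q S *v axial (transpose (Q S) ** Q')"
  using skew_rotation_derivative[OF Q at_within_Icc_neq_bot[OF L S] S rot]
  by (simp add: curvature_def dS_eqI[OF L S Q] bold_j_def bold_def matrix_inv_rotation[OF rot[OF S]]
      jmap_eq_axial)

section \<open>The functional derivatives of the Hamiltonian\<close>

text \<open>The state at one instant, with the tensors reduced to what the variations use: symmetry,
  and for \<open>\<AA>\<close> isotropy, which makes the energy of \<open>p\<close> independent of
  the frame.\<close>

locale rod_configuration =
  fixes L :: real and \<phi> p \<sigma> :: vfield and R :: mfield and \<AA> \<JJ> \<GG> \<HH> :: "real^3^3" and \<alpha> :: real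
  assumes L: "0 < L"
    and \<phi>: "smooth_field L \<phi>" and p: "smooth_field L p" and \<sigma>: "smooth_field L \<sigma>"
    and R: "smooth_field L R"
    and rot: "\<And>S. S \<in> {0..L} \<Longrightarrow> rotation_matrix (R S)"
    and inv_\<AA>: "matrix_inv \<AA> = \<alpha> *\<^sub>R mat 1"
    and sym_\<JJ>: "transpose (matrix_inv \<JJ>) = matrix_inv \<JJ>"
    and sym_\<GG>: "transpose \<GG> = \<GG>"
    and sym_\<HH>: "transpose \<HH> = \<HH>"
begin

abbreviation "H \<equiv> rod_hamiltonian L \<AA> \<JJ> \<GG> \<HH>"

definition "force = (\<lambda>S. tensor \<GG> (R S) (strain L \<phi> R S))"
definition "torque = (\<lambda>S. tensor \<HH> (R S) (curvature L R S))"

definition "sigma_rate = (\<lambda>S. dS L torque S + cross3 (dS L \<phi> S) (force S))"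

definition "grad_phi = (\<lambda>S. - dS L force S)"
definition "grad_p = (\<lambda>S. tensor (matrix_inv \<AA>) (R S) (p S))"
text \<open>The tangent vector at \<open>R S\<close> whose bold axial vector is
  \<open>- sigma_rate S\<close>. Pairing it with a perturbation of the frame is then the scalar
  product of \<open>- sigma_rate S\<close> with \<open>\<delta>\<theta> S\<close>, and the sign in
  \<open>bracket_sigma\<close> turns it into the rate of change of \<open>\<sigma>\<close>.\<close>

definition "grad_R = (\<lambda>S. R S ** jinv (transpose (R S) *v (- sigma_rate S)))"
definition "grad_sigma = (\<lambda>S. tensor (matrix_inv \<JJ>) (R S) (\<sigma> S))"

lemmas smooth_matvec = smooth_field_bilinear[OF L bounded_bilinear_matrix_vector_mult]
  and smooth_matmat = smooth_field_bilinear[OF L bounded_bilinear_matrix_matrix_mult]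
  and smooth_cross = smooth_field_bilinear[OF L bounded_bilinear_cross3]
  and smooth_inner = smooth_field_bilinear[OF L bounded_bilinear_inner]
  and smooth_transpose = smooth_field_linear[OF L bounded_linear_transpose]
  and smooth_jinv = smooth_field_linear[OF L bounded_linear_jinv]
  and smooth_axial = smooth_field_linear[OF L bounded_linear_axial]
  and smooth_dS = smooth_field_dS(2)[OF L]
  and dS = smooth_field_dS(1)[OF L]

lemma smooth_tensor:
  assumes "smooth_field L u"
  shows "smooth_field L (\<lambda>S. tensor X (R S) (u S))"
  by (rule smooth_field_cong[OF L, where f = "\<lambda>S. R S *v (X *v (transpose (R S) *v u S))"])
    (intro smooth_matvec smooth_transpose smooth_field_const[OF L] R assms,
      simp add: tensor_rotation rot)

lemma smooth_strain: "smooth_field L (strain L \<phi> R)"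
  unfolding strain_def[abs_def]
  by (intro smooth_field_diff[OF L] smooth_dS smooth_matvec smooth_field_const[OF L] \<phi> R)

lemma smooth_curvature: "smooth_field L (curvature L R)"
  by (rule smooth_field_cong[OF L, where f = "\<lambda>S. R S *v axial (transpose (R S) ** dS L R S)"])
    (intro smooth_matvec smooth_matmat smooth_transpose smooth_axial smooth_dS R,
      rule curvature_rotation[OF L _ dS[OF R] rot, symmetric])

lemma smooth_force: "smooth_field L force"
  unfolding force_def by (intro smooth_tensor smooth_strain)

lemma smooth_torque: "smooth_field L torque"
  unfolding torque_def by (intro smooth_tensor smooth_curvature)

lemma smooth_sigma_rate: "smooth_field L sigma_rate"
  unfolding sigma_rate_def
  by (intro smooth_field_add[OF L] smooth_dS smooth_cross smooth_torque smooth_force \<phi>)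

text \<open>Only the strain involves \<open>\<phi>\<close>, and it does so affinely. Its variation
  is the derivative of the perturbation; moving that derivative onto the force produces the minus
  sign.\<close>

lemma is_grad_phi:
  assumes V: "V \<subseteq> {\<delta>. smooth_field L \<delta>}"
    and bc: "\<And>\<delta> S. \<delta> \<in> V \<Longrightarrow> S \<in> {0, L} \<Longrightarrow> \<delta> S \<bullet> force S = 0"
  shows "is_grad_phi L V H \<phi> p R \<sigma> grad_phi"
  unfolding is_grad_phi_def
proof (intro conjI ballI)
  show "smooth_field L grad_phi"
    unfolding grad_phi_def by (intro smooth_field_minus[OF L] smooth_dS smooth_force)
  fix \<delta> assume "\<delta> \<in> V"
  then have \<delta>: "smooth_field L \<delta>" using V by auto
  have strain: "strain L (\<lambda>S. \<phi> S + s *\<^sub>R \<delta> S) R S = strain L \<phi> R S + s *\<^sub>R dS L \<delta> S"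
    if S: "S \<in> {0..L}" for s S
  proof -
    have "((\<lambda>S. \<phi> S + s *\<^sub>R \<delta> S) has_vector_derivative dS L \<phi> S + s *\<^sub>R dS L \<delta> S) (at S within {0..L})"
      by (intro has_vector_derivative_add dS[OF \<phi> S]
          bounded_linear.has_vector_derivative[OF bounded_linear_scaleR_right] dS[OF \<delta> S])
    from dS_eqI[OF L S this] show ?thesis
      by (simp add: strain_def)
  qed
  have "((\<lambda>s. H (\<lambda>S. \<phi> S + s *\<^sub>R \<delta> S) p R \<sigma>) has_real_derivative
      integral {0..L} (\<lambda>S. force S \<bullet> dS L \<delta> S)) (at 0)"
    unfolding rod_hamiltonian_def
  proof (rule has_derivative_integral_quadratic)
    show "p S \<bullet> tensor (matrix_inv \<AA>) (R S) (p S) + \<sigma> S \<bullet> tensor (matrix_inv \<JJ>) (R S) (\<sigma> S) +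
        strain L (\<lambda>S. \<phi> S + s *\<^sub>R \<delta> S) R S \<bullet> tensor \<GG> (R S) (strain L (\<lambda>S. \<phi> S + s *\<^sub>R \<delta> S) R S) +
        curvature L R S \<bullet> tensor \<HH> (R S) (curvature L R S) =
      (p S \<bullet> tensor (matrix_inv \<AA>) (R S) (p S) + \<sigma> S \<bullet> tensor (matrix_inv \<JJ>) (R S) (\<sigma> S) +
        strain L \<phi> R S \<bullet> tensor \<GG> (R S) (strain L \<phi> R S) +
        curvature L R S \<bullet> tensor \<HH> (R S) (curvature L R S)) +
      s * (2 * (force S \<bullet> dS L \<delta> S)) + s\<^sup>2 * (dS L \<delta> S \<bullet> tensor \<GG> (R S) (dS L \<delta> S))"
      if "S \<in> {0..L}" for s S
      unfolding strain[OF that] inner_tensor_quadratic[OF rot[OF that] sym_\<GG>] force_def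
      by (simp add: algebra_simps)
  qed (intro smooth_field_continuous smooth_field_add[OF L] smooth_inner smooth_tensor
      smooth_force smooth_strain smooth_curvature smooth_dS p \<sigma> \<delta>)+
  also have "integral {0..L} (\<lambda>S. force S \<bullet> dS L \<delta> S) = integral {0..L} (\<lambda>S. grad_phi S \<bullet> \<delta> S)"
    using integration_by_parts_inner[OF L smooth_force \<delta> bc[OF \<open>\<delta> \<in> V\<close>]]
    by (simp add: grad_phi_def)
  finally show "((\<lambda>s. H (\<lambda>S. \<phi> S + s *\<^sub>R \<delta> S) p R \<sigma>) has_real_derivative
      integral {0..L} (\<lambda>S. grad_phi S \<bullet> \<delta> S)) (at 0)" .
qed

lemma is_grad_p: "is_grad_p L H \<phi> p R \<sigma> grad_p"
  unfolding is_grad_p_def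
proof (intro conjI allI impI)
  show "smooth_field L grad_p"
    unfolding grad_p_def by (intro smooth_tensor p)
  fix \<delta> :: vfield assume \<delta>: "smooth_field L \<delta>"
  show "((\<lambda>s. H \<phi> (\<lambda>S. p S + s *\<^sub>R \<delta> S) R \<sigma>) has_real_derivative
      integral {0..L} (\<lambda>S. grad_p S \<bullet> \<delta> S)) (at 0)"
    unfolding rod_hamiltonian_def
  proof (rule has_derivative_integral_quadratic)
    have sym: "transpose (matrix_inv \<AA>) = matrix_inv \<AA>"
      by (simp add: inv_\<AA> transpose_def mat_def vec_eq_iff)
    show "(p S + s *\<^sub>R \<delta> S) \<bullet> tensor (matrix_inv \<AA>) (R S) (p S + s *\<^sub>R \<delta> S) +
        \<sigma> S \<bullet> tensor (matrix_inv \<JJ>) (R S) (\<sigma> S) +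
        strain L \<phi> R S \<bullet> tensor \<GG> (R S) (strain L \<phi> R S) +
        curvature L R S \<bullet> tensor \<HH> (R S) (curvature L R S) =
      (p S \<bullet> tensor (matrix_inv \<AA>) (R S) (p S) + \<sigma> S \<bullet> tensor (matrix_inv \<JJ>) (R S) (\<sigma> S) +
        strain L \<phi> R S \<bullet> tensor \<GG> (R S) (strain L \<phi> R S) +
        curvature L R S \<bullet> tensor \<HH> (R S) (curvature L R S)) +
      s * (2 * (grad_p S \<bullet> \<delta> S)) + s\<^sup>2 * (\<delta> S \<bullet> tensor (matrix_inv \<AA>) (R S) (\<delta> S))"
      if "S \<in> {0..L}" for s S
      unfolding inner_tensor_quadratic[OF rot[OF that] sym] grad_p_def
      by (simp add: algebra_simps)
  qed (unfold grad_p_def, (intro smooth_field_continuous smooth_field_add[OF L] smooth_inner smooth_tensor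
      smooth_strain smooth_curvature p \<sigma> \<delta>)+)
qed

lemma is_grad_sigma: "is_grad_sigma L H \<phi> p R \<sigma> grad_sigma"
  unfolding is_grad_sigma_def
proof (intro conjI allI impI)
  show "smooth_field L grad_sigma"
    unfolding grad_sigma_def by (intro smooth_tensor \<sigma>)
  fix \<delta> :: vfield assume \<delta>: "smooth_field L \<delta>"
  show "((\<lambda>s. H \<phi> p R (\<lambda>S. \<sigma> S + s *\<^sub>R \<delta> S)) has_real_derivative
      integral {0..L} (\<lambda>S. grad_sigma S \<bullet> \<delta> S)) (at 0)"
    unfolding rod_hamiltonian_def
  proof (rule has_derivative_integral_quadratic)
    show "p S \<bullet> tensor (matrix_inv \<AA>) (R S) (p S) +
        (\<sigma> S + s *\<^sub>R \<delta> S) \<bullet> tensor (matrix_inv \<JJ>) (R S) (\<sigma> S + s *\<^sub>R \<delta> S) +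
        strain L \<phi> R S \<bullet> tensor \<GG> (R S) (strain L \<phi> R S) +
        curvature L R S \<bullet> tensor \<HH> (R S) (curvature L R S) =
      (p S \<bullet> tensor (matrix_inv \<AA>) (R S) (p S) + \<sigma> S \<bullet> tensor (matrix_inv \<JJ>) (R S) (\<sigma> S) +
        strain L \<phi> R S \<bullet> tensor \<GG> (R S) (strain L \<phi> R S) +
        curvature L R S \<bullet> tensor \<HH> (R S) (curvature L R S)) +
      s * (2 * (grad_sigma S \<bullet> \<delta> S)) + s\<^sup>2 * (\<delta> S \<bullet> tensor (matrix_inv \<JJ>) (R S) (\<delta> S))"
      if "S \<in> {0..L}" for s S
      unfolding inner_tensor_quadratic[OF rot[OF that] sym_\<JJ>] grad_sigma_def
      by (simp add: algebra_simps)
  qed (unfold grad_sigma_def, (intro smooth_field_continuous smooth_field_add[OF L] smooth_inner smooth_tensor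
      smooth_strain smooth_curvature p \<sigma> \<delta>)+)
qed

end

section \<open>The variation of the energy in the rotation field\<close>

lemma has_vector_derivative_quadratic:
  fixes f :: "real \<Rightarrow> real^'n"
  assumes "transpose X = X" and f: "(f has_vector_derivative f') (at x within A)"
  shows "((\<lambda>x. f x \<bullet> (X *v f x)) has_vector_derivative 2 * ((X *v f x) \<bullet> f')) (at x within A)"
proof -
  have "f x \<bullet> (X *v f') = (X *v f x) \<bullet> f'"
    by (subst inner_matrix_vector) (simp add: assms(1))
  then show ?thesis
    using bounded_bilinear.has_vector_derivative[OF bounded_bilinear_inner f
        bounded_linear.has_vector_derivative[OF matrix_vector_mul_bounded_linear[of X] f]]
    by (simp add: inner_commute)
qed

lemma transpose_jinv: "transpose (jinv a) = - jinv a"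
  using skew_jinv by (simp add: skew_def)

text \<open>With Q^T Q' = \<open>jinv K\<close>, the variation of this matrix along
  \<open>Q ** jinv w\<close> is \<open>jinv w'\<close> plus a commutator, so K changes by w' + K x
  w. These are the moving components of the ambient derivative (Q w)' = Q w' + Q' w, the second term
  coming from the motion of the frame.\<close>

lemma axial_rotation_variation:
  assumes rot: "rotation_matrix Q" and skew: "skew (transpose Q ** Q')"
  shows "Q *v axial (transpose (Q ** jinv w) ** Q' + transpose Q ** (Q ** jinv w' + Q' ** jinv w)) =
    Q *v w' + Q' *v w"
proof -
  define K where "K = axial (transpose Q ** Q')"
  have K: "jinv K = transpose Q ** Q'"
    unfolding K_def by (rule jinv_axial[OF skew])
  interpret axial: bounded_linear axial by (rule bounded_linear_axial)
  have "transpose (Q ** jinv w) ** Q' + transpose Q ** (Q ** jinv w' + Q' ** jinv w) =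
      (jinv K ** jinv w - jinv w ** jinv K) + jinv w'"
    using rot by (simp add: K matrix_transpose_mul transpose_jinv matrix_add_ldistrib matrix_mul_assoc
        rotation_transpose_mult bounded_bilinear.minus_left[OF bounded_bilinear_matrix_matrix_mult])
  then have "axial (transpose (Q ** jinv w) ** Q' + transpose Q ** (Q ** jinv w' + Q' ** jinv w)) =
      jinv K *v w + w'"
    by (simp add: axial.add axial_commutator)
  also have "Q *v \<dots> = Q *v w' + Q' *v w"
    unfolding K using rot by (simp add: matrix_vector_right_distrib flip: matrix_vector_mul_assoc)
  finally show ?thesis .
qed

text \<open>The components of a fixed vector \<open>f\<close> change by - w x (Q^T f) when the frame
  turns by \<open>w\<close>. Rotations commute with the cross product, and a cyclic permutation of
  the triple product isolates \<open>Q *v w\<close>.\<close>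

lemma inner_rotation_variation:
  assumes rot: "rotation_matrix Q"
  shows "(transpose Q *v n) \<bullet> (transpose (Q ** jinv w) *v f) = - ((Q *v w) \<bullet> cross3 f n)"
proof -
  have "transpose (Q ** jinv w) *v f = - cross3 w (transpose Q *v f)"
    by (simp add: matrix_transpose_mul transpose_jinv flip: matrix_vector_mul_assoc jinv_vector)
      (simp add: matrix_vector_mult_def vec_eq_iff sum_negf)
  then have "(transpose Q *v n) \<bullet> (transpose (Q ** jinv w) *v f) =
      - (n \<bullet> (Q *v cross3 w (transpose Q *v f)))"
    by (simp add: inner_matrix_vector)
  also have "Q *v cross3 w (transpose Q *v f) = cross3 (Q *v w) f"
    using cross_rotation_matrix[OF rot, of w "transpose Q *v f"] rot by simp
  also have "n \<bullet> cross3 (Q *v w) f = (Q *v w) \<bullet> cross3 f n"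
    by (simp add: cross3_simps)
  finally show ?thesis .
qed

context rod_configuration
begin

lemma is_grad_R:
  assumes V: "V \<subseteq> {\<delta>. smooth_field L \<delta>}"
    and bc: "\<And>\<delta> S. \<delta> \<in> V \<Longrightarrow> S \<in> {0, L} \<Longrightarrow> \<delta> S \<bullet> torque S = 0"
  shows "is_grad_R L V H \<phi> p R \<sigma> grad_R"
  unfolding is_grad_R_def
proof (intro conjI ballI allI impI)
  show "smooth_field L grad_R"
    unfolding grad_R_def
    by (intro smooth_matmat smooth_jinv smooth_matvec smooth_transpose smooth_field_minus[OF L]
        smooth_sigma_rate R)
  show "grad_R S \<in> tangent_SO3 (R S)" for S
    unfolding grad_R_def by (rule tangent_SO3_jinv)
  fix \<delta>R \<delta>\<theta> Q r
  assume A: "\<delta>\<theta> \<in> V \<and>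
        (\<forall>S\<in>{0..L}. \<delta>R S \<in> tangent_SO3 (R S) \<and>
                     \<delta>\<theta> S = bold_j (R S) (matrix_inv (R S) ** \<delta>R S)) \<and>
        0 < r \<and> smooth_family {-r<..<r} L Q \<and>
        (\<forall>s\<in>{-r<..<r}. \<forall>S\<in>{0..L}. rotation_matrix (Q s S)) \<and>
        (\<forall>S\<in>{0..L}. Q 0 S = R S \<and> ((\<lambda>s. Q s S) has_vector_derivative \<delta>R S) (at 0))"
  define U where "U = {-r<..<r}"
  have U: "open U" "convex U" "0 \<in> U"
    using A by (auto simp: U_def)
  have \<delta>\<theta>: "\<delta>\<theta> \<in> V" "smooth_field L \<delta>\<theta>"
    using A V by auto
  have rotQ: "rotation_matrix (Q s S)" if "s \<in> U" "S \<in> {0..L}" for s S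
    using A that by (simp add: U_def)
  obtain D where D: "D (0::nat) (0::nat) = Q"
    and cont: "\<And>i j. continuous_on (Sigma U (\<lambda>_. {0..L})) (\<lambda>x. D i j (fst x) (snd x))"
    and Ds: "\<And>i j s S. s \<in> U \<Longrightarrow> S \<in> {0..L} \<Longrightarrow>
           ((\<lambda>s. D i j s S) has_vector_derivative D (Suc i) j s S) (at s within U)"
    and DS: "\<And>i j s S. s \<in> U \<Longrightarrow> S \<in> {0..L} \<Longrightarrow>
           (D i j s has_vector_derivative D i (Suc j) s S) (at S within {0..L})"
    using A unfolding smooth_family_def U_def[symmetric] by blast
  define Qs where "Qs = D 1 0"
  define QS where "QS = D 0 1"
  \<comment> \<open>The single entry \<open>D 1 1\<close> is both the s-derivative of
    \<open>QS\<close> and the S-derivative of \<open>Qs\<close>. This is where the commutation of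
    mixed derivatives enters.\<close>
  define QsS where "QsS = D 1 1"
  define c where "c = (\<lambda>S. transpose (R S) *v \<sigma> S)"
  define \<Gamma> where "\<Gamma> = (\<lambda>s S. transpose (Q s S) *v dS L \<phi> S - axis 3 1)"
  define K where "K = (\<lambda>s S. axial (transpose (Q s S) ** QS s S))"
  define \<Gamma>s where "\<Gamma>s = (\<lambda>s S. transpose (Qs s S) *v dS L \<phi> S)"
  define Ks where "Ks = (\<lambda>s S. axial (transpose (Q s S) ** QsS s S + transpose (Qs s S) ** QS s S))"
  \<comment> \<open>Twice the energy density in moving components. The first two summands are
    constant in \<open>s\<close>.\<close>
  define e where "e = (\<lambda>s S. \<alpha> * (p S \<bullet> p S) + c S \<bullet> (matrix_inv \<JJ> *v c S) +
      \<Gamma> s S \<bullet> (\<GG> *v \<Gamma> s S) + K s S \<bullet> (\<HH> *v K s S))"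
  define es where "es = (\<lambda>s S. 2 * ((\<GG> *v \<Gamma> s S) \<bullet> \<Gamma>s s S) + 2 * ((\<HH> *v K s S) \<bullet> Ks s S))"

  have H_eq: "H \<phi> p (Q s) (\<lambda>S. bold (Q s S) (comps (R S) (\<sigma> S))) = 1/2 * integral (cbox 0 L) (e s)"
    if s: "s \<in> U" for s
  proof -
    have "p S \<bullet> tensor (matrix_inv \<AA>) (Q s S) (p S) +
        bold (Q s S) (comps (R S) (\<sigma> S)) \<bullet> tensor (matrix_inv \<JJ>) (Q s S) (bold (Q s S) (comps (R S) (\<sigma> S))) +
        strain L \<phi> (Q s) S \<bullet> tensor \<GG> (Q s S) (strain L \<phi> (Q s) S) +
        curvature L (Q s) S \<bullet> tensor \<HH> (Q s S) (curvature L (Q s) S) = e s S"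
      if S: "S \<in> {0..L}" for S
    proof -
      note Q = rotQ[OF s S]
      have "tensor (matrix_inv \<AA>) (Q s S) (p S) = \<alpha> *\<^sub>R p S"
        using Q by (simp add: tensor_rotation inv_\<AA> matrix_vector_mult_scaleR
            flip: scaleR_matrix_vector_assoc)
      moreover have "transpose (Q s S) *v bold (Q s S) (comps (R S) (\<sigma> S)) = c S"
        using Q by (simp add: bold_def comps_def matrix_inv_rotation rot[OF S] c_def)
      moreover have "transpose (Q s S) *v strain L \<phi> (Q s) S = \<Gamma> s S"
        using Q by (simp add: strain_def \<Gamma>_def matrix_vector_mult_diff_distrib)
      moreover have "transpose (Q s S) *v curvature L (Q s) S = K s S"
      proof -
        have "(Q s has_vector_derivative QS s S) (at S within {0..L})"
          using DS[OF s S, of 0 0] by (simp add: D QS_def)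
        from curvature_rotation[OF L S this rotQ[OF s]] show ?thesis
          using Q by (simp add: K_def)
      qed
      ultimately show ?thesis
        by (simp add: inner_tensor[OF Q, of _ "matrix_inv \<JJ>"] inner_tensor[OF Q, of _ \<GG>]
            inner_tensor[OF Q, of _ \<HH>] e_def)
    qed
    then show ?thesis
      unfolding rod_hamiltonian_def by (auto intro!: integral_cong)
  qed

  have deriv: "((\<lambda>s. e s S) has_real_derivative es s S) (at s within U)"
    if s: "s \<in> U" and S: "S \<in> {0..L}" for s S
  proof -
    have Q: "((\<lambda>s. Q s S) has_vector_derivative Qs s S) (at s within U)"
      using Ds[OF s S, of 0 0] by (simp add: D Qs_def)
    have QS: "((\<lambda>s. QS s S) has_vector_derivative QsS s S) (at s within U)"
      using Ds[OF s S, of 0 1] by (simp add: QsS_def QS_def)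
    note transpose = bounded_linear.has_vector_derivative[OF bounded_linear_transpose Q]
    have "((\<lambda>s. \<Gamma> s S) has_vector_derivative \<Gamma>s s S) (at s within U)"
      unfolding \<Gamma>_def \<Gamma>s_def
      using has_vector_derivative_diff[OF bounded_bilinear.has_vector_derivative[OF
          bounded_bilinear_matrix_vector_mult transpose has_vector_derivative_const]
          has_vector_derivative_const]
      by simp
    moreover have "((\<lambda>s. K s S) has_vector_derivative Ks s S) (at s within U)"
      unfolding K_def Ks_def
      by (intro bounded_linear.has_vector_derivative[OF bounded_linear_axial]
          bounded_bilinear.has_vector_derivative[OF bounded_bilinear_matrix_matrix_mult transpose QS])
    ultimately have "((\<lambda>s. e s S) has_vector_derivative
        0 + 2 * ((\<GG> *v \<Gamma> s S) \<bullet> \<Gamma>s s S) + 2 * ((\<HH> *v K s S) \<bullet> Ks s S)) (at s within U)"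
      unfolding e_def
      by (intro has_vector_derivative_add has_vector_derivative_quadratic sym_\<GG> sym_\<HH>
          has_vector_derivative_const)
    then show ?thesis
      by (simp add: es_def has_real_derivative_iff_has_vector_derivative)
  qed

  \<comment> \<open>The Leibniz rule asks for joint continuity of the integrand's derivative, so
    order 0 of the calculus is enough.\<close>
  have C: "C_family 0 U L (\<lambda>s. f)" if "smooth_field L f" for f :: vfield
    by (rule smooth_field_imp_C_family[OF that])
  have C_D: "C_family 0 U L Q" "C_family 0 U L Qs" "C_family 0 U L QS" "C_family 0 U L QsS"
    using cont[of 0 0] cont[of 1 0] cont[of 0 1] cont[of 1 1]
    by (simp_all add: D Qs_def QS_def QsS_def)
  note C_ops = C_family_bilinear[OF bounded_bilinear_inner]
    C_family_bilinear[OF bounded_bilinear_matrix_vector_mult]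
    C_family_bilinear[OF bounded_bilinear_matrix_matrix_mult]
    C_family_linear[OF bounded_linear_transpose] C_family_linear[OF bounded_linear_axial]
  have C_matvec: "C_family 0 U L (\<lambda>s S. X *v f s S)" if "C_family 0 U L f"
    for X :: "real^3^3" and f :: "real \<Rightarrow> vfield"
    by (rule C_family_linear[OF matrix_vector_mul_bounded_linear that])
  have C_\<phi>: "C_family 0 U L (\<lambda>s. dS L \<phi>)"
    by (intro C smooth_dS \<phi>)
  have C_\<Gamma>: "C_family 0 U L \<Gamma>"
    unfolding \<Gamma>_def diff_conv_add_uminus by (intro C_family_add C_ops C_D C_\<phi> C_family_const)
  have C_\<Gamma>s: "C_family 0 U L \<Gamma>s"
    unfolding \<Gamma>s_def by (intro C_ops C_D C_\<phi>)
  have C_K: "C_family 0 U L K"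
    unfolding K_def by (intro C_ops C_D)
  have C_Ks: "C_family 0 U L Ks"
    unfolding Ks_def by (intro C_family_add C_ops C_D)
  have C_c: "C_family 0 U L (\<lambda>s. c)"
    unfolding c_def by (intro C smooth_matvec smooth_transpose R \<sigma>)
  have C_e: "C_family 0 U L e"
    unfolding e_def
    by (intro C_family_add C_ops C_matvec C_\<Gamma> C_K C_c C[OF p]
        C_family_linear[OF bounded_linear_mult_right])
  have C_es: "C_family 0 U L es"
    unfolding es_def
    by (intro C_family_add C_ops C_matvec C_\<Gamma> C_K C_\<Gamma>s C_Ks
        C_family_linear[OF bounded_linear_mult_right])

  have "((\<lambda>s. integral (cbox 0 L) (e s)) has_real_derivative integral (cbox 0 L) (es 0)) (at 0 within U)"
  proof (rule leibniz_rule_field_derivative)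
    show "e s integrable_on cbox 0 L" if "s \<in> U" for s
      using continuous_on_section[OF C_family_continuous[OF C_e] that]
      by (auto intro!: integrable_continuous_real)
    show "continuous_on (Sigma U (\<lambda>_. cbox 0 L)) (\<lambda>(s, S). es s S)"
      using C_family_continuous[OF C_es] by (simp add: split_beta)
    show "((\<lambda>s. e s S) has_real_derivative es s S) (at s within U)" if "s \<in> U" "S \<in> cbox 0 L" for s S
      using deriv that by simp
  qed (fact U)+
  then have "((\<lambda>s. 1/2 * integral (cbox 0 L) (e s)) has_real_derivative
      1/2 * integral (cbox 0 L) (es 0)) (at 0)"
    unfolding at_within_open[OF U(3,1)] by (rule DERIV_cmult)
  then have H_deriv: "((\<lambda>s. H \<phi> p (Q s) (\<lambda>S. bold (Q s S) (comps (R S) (\<sigma> S)))) has_real_derivative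
      1/2 * integral (cbox 0 L) (es 0)) (at 0)"
    by (rule has_field_derivative_transform_within_open[OF _ U(1,3)]) (simp add: H_eq)

  define w where "w = (\<lambda>S. transpose (R S) *v \<delta>\<theta> S)"
  have w: "smooth_field L w"
    unfolding w_def by (intro smooth_matvec smooth_transpose R \<delta>\<theta>)
  have \<delta>\<theta>_eq: "\<delta>\<theta> S = R S *v w S" if "S \<in> {0..L}" for S
    using rot[OF that] by (simp add: w_def)
  have \<delta>R_eq: "\<delta>R S = R S ** jinv (w S)" if S: "S \<in> {0..L}" for S
  proof -
    have "\<delta>\<theta> S = R S *v jmap (transpose (R S) ** \<delta>R S)"
      using A S by (simp add: bold_j_def bold_def matrix_inv_rotation rot)
    then have "w S = jmap (transpose (R S) ** \<delta>R S)"
      using rot[OF S] by (simp add: w_def)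
    then show ?thesis
      using tangent_SO3_eq[OF rot[OF S], of "\<delta>R S"] A S by simp
  qed
  have Q_0: "Q 0 S = R S" if "S \<in> {0..L}" for S
    using A that by simp
  have Qs_0: "Qs 0 S = R S ** jinv (w S)" if S: "S \<in> {0..L}" for S
  proof -
    have "((\<lambda>s. Q s S) has_vector_derivative Qs 0 S) (at 0)"
      using Ds[OF U(3) S, of 0 0] by (simp add: D Qs_def at_within_open[OF U(3,1)])
    moreover have "((\<lambda>s. Q s S) has_vector_derivative \<delta>R S) (at 0)"
      using A S by simp
    ultimately show ?thesis
      using vector_derivative_unique_at \<delta>R_eq[OF S] by metis
  qed
  have QS_0: "QS 0 S = dS L R S" if S: "S \<in> {0..L}" for S
  proof -
    have "(R has_vector_derivative QS 0 S) (at S within {0..L})"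
      using has_vector_derivative_transform[OF S _ DS[OF U(3) S, of 0 0], of R] Q_0
      by (simp add: D QS_def)
    then show ?thesis
      using dS_eqI[OF L S] by metis
  qed
  \<comment> \<open>Read as an S-derivative of the initial velocity \<open>R ** jinv w\<close>, the
    mixed derivative at s = 0 is determined by \<open>R\<close> and \<open>w\<close>, whatever the
    family.\<close>
  have QsS_0: "QsS 0 S = R S ** jinv (dS L w S) + dS L R S ** jinv (w S)"
    if S: "S \<in> {0..L}" for S
  proof -
    have "((\<lambda>S. R S ** jinv (w S)) has_vector_derivative QsS 0 S) (at S within {0..L})"
      using has_vector_derivative_transform[OF S _ DS[OF U(3) S, of 1 0], of "\<lambda>S. R S ** jinv (w S)"] Qs_0
      by (simp add: Qs_def QsS_def)
    moreover have "((\<lambda>S. R S ** jinv (w S)) has_vector_derivative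
        R S ** jinv (dS L w S) + dS L R S ** jinv (w S)) (at S within {0..L})"
      by (intro bounded_bilinear.has_vector_derivative[OF bounded_bilinear_matrix_matrix_mult]
          bounded_linear.has_vector_derivative[OF bounded_linear_jinv] dS S R w)
    ultimately show ?thesis
      using vector_derivative_unique_within[OF at_within_Icc_neq_bot[OF L S]] by blast
  qed
  note Q0 = Q_0 Qs_0 QS_0 QsS_0
  have es0: "es 0 S = 2 * (torque S \<bullet> dS L \<delta>\<theta> S - \<delta>\<theta> S \<bullet> cross3 (dS L \<phi> S) (force S))"
    if S: "S \<in> {0..L}" for S
  proof -
    note rot = rot[OF S]
    have force: "\<GG> *v \<Gamma> 0 S = transpose (R S) *v force S"
      using rot by (simp add: force_def tensor_rotation \<Gamma>_def Q0[OF S] strain_def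
          matrix_vector_mult_diff_distrib)
    have torque: "\<HH> *v K 0 S = transpose (R S) *v torque S"
      using rot curvature_rotation[OF L S dS[OF R S] rod_configuration.rot[OF rod_configuration_axioms]]
      by (simp add: torque_def tensor_rotation K_def Q0[OF S])
    have skew: "skew (transpose (R S) ** dS L R S)"
      by (rule skew_rotation_derivative[OF dS[OF R S] at_within_Icc_neq_bot[OF L S] S
            rod_configuration.rot[OF rod_configuration_axioms]])
    have "((\<lambda>S. R S *v w S) has_vector_derivative R S *v dS L w S + dS L R S *v w S) (at S within {0..L})"
      by (intro bounded_bilinear.has_vector_derivative[OF bounded_bilinear_matrix_vector_mult] dS S R w)
    from dS_eqI[OF L S has_vector_derivative_transform[OF S \<delta>\<theta>_eq this]]
    have "dS L \<delta>\<theta> S = R S *v Ks 0 S"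
      unfolding axial_rotation_variation[OF rot skew, symmetric] Ks_def Q0[OF S]
      by (simp add: add.commute)
    then have "(\<HH> *v K 0 S) \<bullet> Ks 0 S = torque S \<bullet> dS L \<delta>\<theta> S"
      by (simp add: torque inner_matrix_vector)
    moreover have "(\<GG> *v \<Gamma> 0 S) \<bullet> \<Gamma>s 0 S = - (\<delta>\<theta> S \<bullet> cross3 (dS L \<phi> S) (force S))"
      unfolding force \<Gamma>s_def Q0[OF S] inner_rotation_variation[OF rot] \<delta>\<theta>_eq[OF S] ..
    ultimately show ?thesis
      by (simp add: es_def)
  qed
  have pairing: "mat_pairing (grad_R S) (\<delta>R S) =
      - (dS L torque S \<bullet> \<delta>\<theta> S) - \<delta>\<theta> S \<bullet> cross3 (dS L \<phi> S) (force S)"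
    if S: "S \<in> {0..L}" for S
    unfolding grad_R_def \<delta>R_eq[OF S] mat_pairing_rotation[OF rot[OF S]] mat_pairing_jinv
    using \<delta>\<theta>_eq[OF S]
    by (simp add: inner_matrix_vector[symmetric] sigma_rate_def inner_add_left
        inner_diff_left inner_commute[of _ "cross3 (dS L \<phi> S) (force S)"])
  have "1/2 * integral (cbox 0 L) (es 0) =
      1/2 * integral {0..L} (\<lambda>S. 2 * (torque S \<bullet> dS L \<delta>\<theta> S - \<delta>\<theta> S \<bullet> cross3 (dS L \<phi> S) (force S)))"
    using es0 by (auto intro!: integral_cong)
  also have "\<dots> = integral {0..L} (\<lambda>S. torque S \<bullet> dS L \<delta>\<theta> S - \<delta>\<theta> S \<bullet> cross3 (dS L \<phi> S) (force S))"
    by (subst integral_mult_right) simp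
  also have "\<dots> = integral {0..L} (\<lambda>S. torque S \<bullet> dS L \<delta>\<theta> S) -
      integral {0..L} (\<lambda>S. \<delta>\<theta> S \<bullet> cross3 (dS L \<phi> S) (force S))"
    by (intro integral_diff integrable_continuous_real smooth_field_continuous smooth_inner
        smooth_cross smooth_dS smooth_torque smooth_force \<phi> \<delta>\<theta>)
  also have "\<dots> = integral {0..L} (\<lambda>S. - (dS L torque S \<bullet> \<delta>\<theta> S)) -
      integral {0..L} (\<lambda>S. \<delta>\<theta> S \<bullet> cross3 (dS L \<phi> S) (force S))"
    using integration_by_parts_inner[OF L smooth_torque \<delta>\<theta>(2) bc[OF \<delta>\<theta>(1)]] by simp
  also have "\<dots> = integral {0..L} (\<lambda>S. - (dS L torque S \<bullet> \<delta>\<theta> S) -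
      \<delta>\<theta> S \<bullet> cross3 (dS L \<phi> S) (force S))"
    by (intro integral_diff[symmetric] integrable_continuous_real smooth_field_continuous
        smooth_field_minus[OF L] smooth_inner smooth_cross smooth_dS smooth_torque smooth_force \<phi> \<delta>\<theta>)
  also have "\<dots> = integral {0..L} (\<lambda>S. mat_pairing (grad_R S) (\<delta>R S))"
    using pairing by (intro integral_cong) simp
  finally show "((\<lambda>s. H \<phi> p (Q s) (\<lambda>S. bold (Q s S) (comps (R S) (\<sigma> S)))) has_real_derivative
      integral {0..L} (\<lambda>S. mat_pairing (grad_R S) (\<delta>R S))) (at 0)"
    using H_deriv by simp
qed

end

section \<open>Uniqueness of functional derivatives\<close>

lemma is_grad_phi_unique:
  assumes L: "0 < L" and V: "{\<delta>. smooth_field L \<delta> \<and> \<delta> 0 = 0 \<and> \<delta> L = 0} \<subseteq> V"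
    and g: "is_grad_phi L V F \<phi> p R \<sigma> g" and h: "is_grad_phi L V F \<phi> p R \<sigma> h"
    and S: "S \<in> {0..L}"
  shows "g S = h S"
proof (rule fundamental_lemma_variations[OF L _ _ _ S])
  show "smooth_field L g" "smooth_field L h"
    using g h by (simp_all add: is_grad_phi_def)
  fix \<delta> :: vfield assume "smooth_field L \<delta>" "\<delta> 0 = 0" "\<delta> L = 0"
  with V have "\<delta> \<in> V" by blast
  with g h show "integral {0..L} (\<lambda>S. g S \<bullet> \<delta> S) = integral {0..L} (\<lambda>S. h S \<bullet> \<delta> S)"
    unfolding is_grad_phi_def by (blast intro: DERIV_unique)
qed

lemma is_grad_p_unique:
  assumes L: "0 < L" and g: "is_grad_p L F \<phi> p R \<sigma> g" and h: "is_grad_p L F \<phi> p R \<sigma> h"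
    and S: "S \<in> {0..L}"
  shows "g S = h S"
proof (rule fundamental_lemma_variations[OF L _ _ _ S])
  show "smooth_field L g" "smooth_field L h"
    using g h by (simp_all add: is_grad_p_def)
  fix \<delta> :: vfield assume "smooth_field L \<delta>"
  with g h show "integral {0..L} (\<lambda>S. g S \<bullet> \<delta> S) = integral {0..L} (\<lambda>S. h S \<bullet> \<delta> S)"
    unfolding is_grad_p_def by (blast intro: DERIV_unique)
qed

lemma is_grad_sigma_unique:
  assumes L: "0 < L" and g: "is_grad_sigma L F \<phi> p R \<sigma> g" and h: "is_grad_sigma L F \<phi> p R \<sigma> h"
    and S: "S \<in> {0..L}"
  shows "g S = h S"
proof (rule fundamental_lemma_variations[OF L _ _ _ S])
  show "smooth_field L g" "smooth_field L h"
    using g h by (simp_all add: is_grad_sigma_def)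
  fix \<delta> :: vfield assume "smooth_field L \<delta>"
  with g h show "integral {0..L} (\<lambda>S. g S \<bullet> \<delta> S) = integral {0..L} (\<lambda>S. h S \<bullet> \<delta> S)"
    unfolding is_grad_sigma_def by (blast intro: DERIV_unique)
qed

section \<open>Realising perturbations by families of rotations\<close>

lemma C_family_parameter: "C_family n T L (\<lambda>t S. t)"
proof (cases n)
  case (Suc m)
  have "C_family m T L (\<lambda>t S. t)"
  proof (induction m)
    case (Suc m)
    show ?case
      by (rule C_family_SucI[OF Suc C_family_const[of _ _ _ 1] C_family_const[of _ _ _ 0]])
        (auto intro!: derivative_eq_intros)
  qed (auto intro!: continuous_intros)
  then show ?thesis
    unfolding Suc by (rule C_family_SucI[OF _ C_family_const[of _ _ _ 1] C_family_const[of _ _ _ 0]])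
      (auto intro!: derivative_eq_intros)
qed (auto intro!: continuous_intros)

text \<open>The only denominator is 1 + |a|^2, which never vanishes, so every order of the calculus
  applies and \<open>s\<close> may range over any open interval.\<close>

lemma smooth_family_cayley:
  assumes L: "0 < L" and T: "open T" "convex T" and R: "smooth_field L R" and w: "smooth_field L w"
  shows "smooth_family T L (\<lambda>s S. R S ** cayley ((s / 2) *\<^sub>R w S))"
proof (rule C_family_imp_smooth_family[OF T L])
  fix n
  define a where "a = (\<lambda>s S. (s / 2) *\<^sub>R w S)"
  have a: "C_family n T L a"
    unfolding a_def
    by (intro C_family_bilinear[OF bounded_bilinear_scaleR] smooth_field_imp_C_family[OF w]
        C_family_linear[OF bounded_linear_divide] C_family_parameter)
  have "1 + a s S \<bullet> a s S \<noteq> 0" for s S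
    by (smt (verit) inner_ge_zero)
  then have "C_family n T L (\<lambda>s S. R S ** cayley (a s S))"
    unfolding cayley_def
    by (intro C_family_bilinear[OF bounded_bilinear_matrix_matrix_mult] smooth_field_imp_C_family[OF R]
        C_family_add C_family_const C_family_bilinear[OF bounded_bilinear_scaleR]
        C_family_linear[OF bounded_linear_mult_right] C_family_inverse
        C_family_bilinear[OF bounded_bilinear_inner] C_family_linear[OF bounded_linear_jinv] a)
  then show "C_family n T L (\<lambda>s S. R S ** cayley ((s / 2) *\<^sub>R w S))"
    unfolding a_def .
qed

text \<open>\<open>cayley a\<close> is 1 + 2 \<open>jinv a\<close> up to second order; halving the
  argument makes the velocity at 0 equal to \<open>jinv w\<close>.\<close>

lemma cayley_derivative:
  "((\<lambda>s. Q ** cayley ((s / 2) *\<^sub>R w)) has_vector_derivative Q ** jinv w) (at 0)"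
proof -
  interpret jinv: bounded_linear jinv by (rule bounded_linear_jinv)
  have "cayley ((s / 2) *\<^sub>R w) = mat 1 + (s * inverse (1 + (s / 2)\<^sup>2 * (w \<bullet> w))) *\<^sub>R jinv w
      + (s\<^sup>2 / 2 * inverse (1 + (s / 2)\<^sup>2 * (w \<bullet> w))) *\<^sub>R (jinv w ** jinv w)" for s
    by (simp add: cayley_def jinv.scaleR scaleR_add_right power2_eq_square
        bounded_bilinear.scaleR_left[OF bounded_bilinear_matrix_matrix_mult]
        bounded_bilinear.scaleR_right[OF bounded_bilinear_matrix_matrix_mult] algebra_simps)
  moreover have "((\<lambda>s. mat 1 + (s * inverse (1 + (s / 2)\<^sup>2 * (w \<bullet> w))) *\<^sub>R jinv w
      + (s\<^sup>2 / 2 * inverse (1 + (s / 2)\<^sup>2 * (w \<bullet> w))) *\<^sub>R (jinv w ** jinv w)) has_vector_derivative jinv w) (at 0)"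
    by (auto intro!: derivative_eq_intros)
  ultimately have "((\<lambda>s. cayley ((s / 2) *\<^sub>R w)) has_vector_derivative jinv w) (at 0)"
    by simp
  then show ?thesis
    by (rule bounded_linear.has_vector_derivative[OF
          bounded_bilinear.bounded_linear_right[OF bounded_bilinear_matrix_matrix_mult]])
qed

lemma rotation_matrix_mult:
  "rotation_matrix P \<Longrightarrow> rotation_matrix Q \<Longrightarrow> rotation_matrix (P ** Q :: real^3^3)"
  by (simp add: rotation_matrix_def orthogonal_matrix_mul det_mul)

lemma cayley_0: "cayley 0 = mat 1"
  using linear_0[OF bounded_linear.linear[OF bounded_linear_jinv]]
  by (simp add: cayley_def)

text \<open>The variation \<open>\<delta>\<close> of the rotation field is realised by the Cayley transform, which, unlike
  Rodrigues' formula, is rational in its argument and so needs no division by its length.\<close>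

lemma is_grad_R_unique:
  assumes L: "0 < L" and V: "{\<delta>. smooth_field L \<delta> \<and> \<delta> 0 = 0 \<and> \<delta> L = 0} \<subseteq> V"
    and R: "smooth_field L R" and rot: "\<And>S. S \<in> {0..L} \<Longrightarrow> rotation_matrix (R S)"
    and g: "is_grad_R L V F \<phi> p R \<sigma> g" and h: "is_grad_R L V F \<phi> p R \<sigma> h"
    and S: "S \<in> {0..L}"
  shows "g S = h S"
proof -
  \<comment> \<open>The bold axial vector of a matrix field. It turns tangent gradients into vector
    fields, to which the fundamental lemma applies.\<close>
  define \<gamma> where "\<gamma> = (\<lambda>k S. R S *v axial (transpose (R S) ** k S))"
  have smooth: "smooth_field L k \<Longrightarrow> smooth_field L (\<gamma> k)" for k
    unfolding \<gamma>_def
    by (intro smooth_field_bilinear[OF L bounded_bilinear_matrix_vector_mult] R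
        smooth_field_linear[OF L bounded_linear_axial] smooth_field_linear[OF L bounded_linear_transpose]
        smooth_field_bilinear[OF L bounded_bilinear_matrix_matrix_mult])
  have \<gamma>: "k S = R S ** jinv (transpose (R S) *v \<gamma> k S)"
    if "is_grad_R L V F \<phi> p R \<sigma> k" and S: "S \<in> {0..L}" for k S
  proof -
    have "k S \<in> tangent_SO3 (R S)"
      using that by (simp add: is_grad_R_def)
    then have "skew (transpose (R S) ** k S)"
      using rot[OF S] by (auto simp: tangent_SO3_def)
    then show ?thesis
      using rot[OF S] by (simp add: \<gamma>_def jinv_axial)
  qed
  \<comment> \<open>The function of \<open>s\<close> depends on the perturbation but not on
    \<open>k\<close>, so two gradients \<open>g\<close> and \<open>h\<close> yield two values for
    one derivative.\<close>
  have deriv: "((\<lambda>s. F \<phi> p (\<lambda>S. R S ** cayley ((s / 2) *\<^sub>R (transpose (R S) *v \<delta> S)))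
      (\<lambda>S. bold (R S ** cayley ((s / 2) *\<^sub>R (transpose (R S) *v \<delta> S))) (comps (R S) (\<sigma> S))))
      has_real_derivative integral {0..L} (\<lambda>S. \<gamma> k S \<bullet> \<delta> S)) (at 0)"
    if k: "is_grad_R L V F \<phi> p R \<sigma> k" and \<delta>: "smooth_field L \<delta>" "\<delta> \<in> V" for k \<delta>
  proof -
    define w where "w = (\<lambda>S. transpose (R S) *v \<delta> S)"
    have w: "smooth_field L w"
      unfolding w_def by (intro smooth_field_bilinear[OF L bounded_bilinear_matrix_vector_mult]
          smooth_field_linear[OF L bounded_linear_transpose] R \<delta>)
    have bold: "\<delta> S = bold_j (R S) (matrix_inv (R S) ** (R S ** jinv (w S)))" if "S \<in> {0..L}" for S
      using rot[OF that] by (simp add: bold_j_def bold_def matrix_inv_rotation w_def)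
    have "((\<lambda>s. F \<phi> p (\<lambda>S. R S ** cayley ((s / 2) *\<^sub>R w S))
      (\<lambda>S. bold (R S ** cayley ((s / 2) *\<^sub>R w S)) (comps (R S) (\<sigma> S))))
      has_real_derivative integral {0..L} (\<lambda>S. mat_pairing (k S) (R S ** jinv (w S)))) (at 0)"
    \<comment> \<open>The half-width 1 is arbitrary: the Cayley family is smooth and consists of
      rotations for all \<open>s\<close>.\<close>
    proof (rule k[unfolded is_grad_R_def, THEN conjunct2, THEN conjunct2, rule_format, of \<delta> _ 1],
        intro conjI ballI)
      show "smooth_family {-1<..<1} L (\<lambda>s S. R S ** cayley ((s / 2) *\<^sub>R w S))"
        by (rule smooth_family_cayley[OF L _ _ R w]) auto
    qed (use \<delta>(2) bold rot in \<open>auto intro: tangent_SO3_jinv cayley_derivative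
      rotation_matrix_mult rotation_cayley simp: cayley_0\<close>)
    also have "integral {0..L} (\<lambda>S. mat_pairing (k S) (R S ** jinv (w S))) =
        integral {0..L} (\<lambda>S. \<gamma> k S \<bullet> \<delta> S)"
    proof (rule integral_cong)
      fix S assume S: "S \<in> {0..L}"
      have "mat_pairing (k S) (R S ** jinv (w S)) = (transpose (R S) *v \<gamma> k S) \<bullet> w S"
        by (subst \<gamma>[OF k S]) (simp add: mat_pairing_rotation[OF rot[OF S]] mat_pairing_jinv)
      also have "\<dots> = \<gamma> k S \<bullet> \<delta> S"
        using rot[OF S] by (simp add: w_def flip: inner_matrix_vector)
      finally show "mat_pairing (k S) (R S ** jinv (w S)) = \<gamma> k S \<bullet> \<delta> S" .
    qed
    finally show ?thesis
      unfolding w_def .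
  qed
  have "\<gamma> g S = \<gamma> h S"
  proof (rule fundamental_lemma_variations[OF L _ _ _ S])
    show "smooth_field L (\<gamma> g)" "smooth_field L (\<gamma> h)"
      using g h by (auto intro!: smooth simp: is_grad_R_def)
    show "integral {0..L} (\<lambda>S. \<gamma> g S \<bullet> \<delta> S) = integral {0..L} (\<lambda>S. \<gamma> h S \<bullet> \<delta> S)"
      if "smooth_field L \<delta>" "\<delta> 0 = 0" "\<delta> L = 0" for \<delta>
      using deriv[OF g that(1)] deriv[OF h that(1)] V that by (blast intro: DERIV_unique)
  qed
  then show ?thesis
    using \<gamma>[OF g S] \<gamma>[OF h S] by metis
qed

section \<open>The brackets of the coordinates with the Hamiltonian\<close>

text \<open>The bracket with \<open>\<sigma>\<close> is the one with content: because
  \<open>hR\<close> is tangent at \<open>R\<close>, its pairing with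
  \<open>R ** bold_jinv R w\<close> reduces to the scalar product of \<open>w\<close> with the bold
  axial vector of \<open>hR\<close>. For the other three coordinates the definitions match
  directly.\<close>

lemma coordinate_brackets:
  assumes rot: "\<And>S. S \<in> {0..L} \<Longrightarrow> rotation_matrix (R S)"
    and tangent: "\<And>S. S \<in> {0..L} \<Longrightarrow> hR S \<in> tangent_SO3 (R S)"
  shows "coordinate_brackets_from_bracket L R (h\<phi>, hp, hR, h\<sigma>)"
proof -
  have [simp]: "bold_jinv Q 0 = 0" for Q
    using linear_0[OF bounded_linear.linear[OF bounded_linear_jinv]]
    by (simp add: bold_jinv_def comps_def)
  have [simp]: "mat_pairing M 0 = 0" "mat_pairing 0 M = 0" for M
    by (simp_all add: mat_pairing_def trace_def matrix_matrix_mult_def transpose_def)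
  have "w S \<bullet> bold_j (R S) (matrix_inv (R S) ** hR S) = mat_pairing (hR S) (R S ** bold_jinv (R S) (w S))"
    if S: "S \<in> {0..L}" for w :: vfield and S
    using rot[OF S]
    by (subst (2) tangent_SO3_eq[OF rot[OF S] tangent[OF S]])
      (simp add: mat_pairing_rotation mat_pairing_jinv bold_jinv_def comps_def matrix_inv_rotation
        bold_j_def bold_def inner_matrix_vector inner_commute)
  then have "integral {0..L} (\<lambda>S. w S \<bullet> bracket_sigma R (h\<phi>, hp, hR, h\<sigma>) S) =
      rod_bracket L R (\<lambda>_. 0, \<lambda>_. 0, \<lambda>_. 0, w) (h\<phi>, hp, hR, h\<sigma>)" for w
    unfolding rod_bracket_def bracket_sigma_def by (auto intro!: integral_cong)
  then show ?thesis
    by (simp add: coordinate_brackets_from_bracket_def rod_bracket_def bracket_phi_def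
        bracket_p_def bracket_R_def inner_commute)
qed

context rod_configuration
begin

context
  fixes V\<phi> V\<theta> :: "vfield set"
  assumes V\<phi>: "V\<phi> \<subseteq> {\<delta>. smooth_field L \<delta>}" and V\<theta>: "V\<theta> \<subseteq> {\<delta>. smooth_field L \<delta>}"
    and bc_\<phi>: "\<And>\<delta> S. \<delta> \<in> V\<phi> \<Longrightarrow> S \<in> {0, L} \<Longrightarrow> \<delta> S \<bullet> tensor \<GG> (R S) (strain L \<phi> R S) = 0"
    and bc_\<theta>: "\<And>\<delta> S. \<delta> \<in> V\<theta> \<Longrightarrow> S \<in> {0, L} \<Longrightarrow> \<delta> S \<bullet> tensor \<HH> (R S) (curvature L R S) = 0"
begin

lemma is_gradient_H: "is_gradient L V\<phi> V\<theta> H \<phi> p R \<sigma> (grad_phi, grad_p, grad_R, grad_sigma)"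
  using is_grad_phi[OF V\<phi>] is_grad_R[OF V\<theta>] bc_\<phi> bc_\<theta> is_grad_p is_grad_sigma
  by (simp add: is_gradient_def force_def torque_def)

text \<open>The bracket expressions use a gradient pointwise, so agreement on [0, L] with the
  explicit one suffices. The inclusions in \<open>V0\<close> supply the test fields for this
  agreement in the slots of \<open>\<phi>\<close> and \<open>R\<close>, where admissibility is
  restricted.\<close>

lemma brackets_H:
  assumes dH: "is_gradient L V\<phi> V\<theta> H \<phi> p R \<sigma> dH"
    and V0: "{\<delta>. smooth_field L \<delta> \<and> \<delta> 0 = 0 \<and> \<delta> L = 0} \<subseteq> V\<phi>"
      "{\<delta>. smooth_field L \<delta> \<and> \<delta> 0 = 0 \<and> \<delta> L = 0} \<subseteq> V\<theta>"
  shows "coordinate_brackets_from_bracket L R dH"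
    and "S \<in> {0..L} \<Longrightarrow> bracket_phi dH S = tensor (matrix_inv \<AA>) (R S) (p S)"
    and "S \<in> {0..L} \<Longrightarrow> bracket_p dH S = dS L (\<lambda>S. tensor \<GG> (R S) (strain L \<phi> R S)) S"
    and "S \<in> {0..L} \<Longrightarrow> bracket_R R dH S
           = R S ** bold_jinv (R S) (tensor (matrix_inv \<JJ>) (R S) (\<sigma> S))"
    and "S \<in> {0..L} \<Longrightarrow> bracket_sigma R dH S
           = dS L (\<lambda>S. tensor \<HH> (R S) (curvature L R S)) S
             + cross3 (dS L \<phi> S) (tensor \<GG> (R S) (strain L \<phi> R S))"
proof -
  obtain h\<phi> hp hR h\<sigma> where dH_eq: "dH = (h\<phi>, hp, hR, h\<sigma>)"
    by (cases dH)
  have h: "is_grad_phi L V\<phi> H \<phi> p R \<sigma> h\<phi>" "is_grad_p L H \<phi> p R \<sigma> hp"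
    "is_grad_R L V\<theta> H \<phi> p R \<sigma> hR" "is_grad_sigma L H \<phi> p R \<sigma> h\<sigma>"
    using dH by (simp_all add: is_gradient_def dH_eq)
  have g: "is_grad_phi L V\<phi> H \<phi> p R \<sigma> grad_phi" "is_grad_p L H \<phi> p R \<sigma> grad_p"
    "is_grad_R L V\<theta> H \<phi> p R \<sigma> grad_R" "is_grad_sigma L H \<phi> p R \<sigma> grad_sigma"
    using is_gradient_H by (simp_all add: is_gradient_def)
  note eq = is_grad_phi_unique[OF L V0(1) h(1) g(1)] is_grad_p_unique[OF L h(2) g(2)]
    is_grad_sigma_unique[OF L h(4) g(4)]
  show "coordinate_brackets_from_bracket L R dH"
    unfolding dH_eq by (rule coordinate_brackets[OF rot]) (use h(3) in \<open>simp_all add: is_grad_R_def\<close>)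
  assume S: "S \<in> {0..L}"
  show "bracket_phi dH S = tensor (matrix_inv \<AA>) (R S) (p S)"
    using eq(2)[OF S] by (simp add: bracket_phi_def dH_eq grad_p_def)
  show "bracket_p dH S = dS L (\<lambda>S. tensor \<GG> (R S) (strain L \<phi> R S)) S"
    using eq(1)[OF S] by (simp add: bracket_p_def dH_eq grad_phi_def force_def)
  show "bracket_R R dH S = R S ** bold_jinv (R S) (tensor (matrix_inv \<JJ>) (R S) (\<sigma> S))"
    using eq(3)[OF S] by (simp add: bracket_R_def dH_eq grad_sigma_def)
  have "hR S = grad_R S"
    by (rule is_grad_R_unique[OF L V0(2) R _ h(3) g(3) S]) (rule rot)
  then have "bracket_sigma R dH S = sigma_rate S"
    using rot[OF S]
    by (simp add: bracket_sigma_def dH_eq grad_R_def bold_j_def bold_def matrix_inv_rotation)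
  then show "bracket_sigma R dH S
      = dS L (\<lambda>S. tensor \<HH> (R S) (curvature L R S)) S
        + cross3 (dS L \<phi> S) (tensor \<GG> (R S) (strain L \<phi> R S))"
    by (simp add: sigma_rate_def torque_def force_def)
qed

end

end

section \<open>The constitutive tensors and the equations of motion\<close>

lemma transpose_diag3: "transpose (diag3 a b c) = diag3 a b c"
  by (simp add: diag3_def transpose_def vec_eq_iff)

lemma matrix_inv_scaled_diag3:
  assumes "r \<noteq> 0" "a \<noteq> 0" "b \<noteq> 0" "c \<noteq> 0"
  shows "matrix_inv (r *\<^sub>R diag3 a b c) = diag3 (1 / (r * a)) (1 / (r * b)) (1 / (r * c))"
  by (rule matrix_inv_eqI)
    (use assms in \<open>simp_all add: diag3_def matrix_matrix_mult_def vec_eq_iff forall_3 sum_3 mat_def\<close>)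

lemma matrix_inv_scaleR_mat: "r \<noteq> 0 \<Longrightarrow> matrix_inv (r *\<^sub>R mat 1 :: real^3^3) = inverse r *\<^sub>R mat 1"
  by (rule matrix_inv_eqI)
    (simp_all add: bounded_bilinear.scaleR_left[OF bounded_bilinear_matrix_matrix_mult]
      bounded_bilinear.scaleR_right[OF bounded_bilinear_matrix_matrix_mult])

theorem theorem4p4:
  fixes L E G A \<rho> I\<^sub>1 I\<^sub>2 I\<^sub>3 :: real
    and \<AA> \<JJ> \<GG> \<HH> :: "real^3^3"
    and T :: "real set"
    and \<phi> p \<sigma> :: "real \<Rightarrow> real \<Rightarrow> real^3"
    and R :: "real \<Rightarrow> real \<Rightarrow> real^3^3"
    and V\<phi> V\<theta> :: "real \<Rightarrow> vfield set"
    and H :: functional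
  assumes "0 < L"
    and "0 < E" "0 < G" "0 < A" "0 < \<rho>" "0 < I\<^sub>1" "0 < I\<^sub>2" "0 < I\<^sub>3"
    and "\<AA> = (\<rho> * A) *\<^sub>R mat 1"
    and "\<JJ> = \<rho> *\<^sub>R diag3 I\<^sub>1 I\<^sub>2 I\<^sub>3"
    and "\<GG> = diag3 (G * A) (G * A) (E * A)"
    and "\<HH> = diag3 (E * I\<^sub>1) (E * I\<^sub>2) (G * I\<^sub>3)"
    and H_def: "H = rod_hamiltonian L \<AA> \<JJ> \<GG> \<HH>"
    and "is_interval T" "\<exists>a\<in>T. \<exists>b\<in>T. a < b"
    and "smooth_family T L \<phi>" "smooth_family T L p" "smooth_family T L R" "smooth_family T L \<sigma>"
    and "\<And>t S. t \<in> T \<Longrightarrow> S \<in> {0..L} \<Longrightarrow> rotation_matrix (R t S)"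
    and "\<And>t. t \<in> T \<Longrightarrow> V\<phi> t \<subseteq> {\<delta>. smooth_field L \<delta>}"
    and "\<And>t. t \<in> T \<Longrightarrow> V\<theta> t \<subseteq> {\<delta>. smooth_field L \<delta>}"
    and "\<And>t. t \<in> T \<Longrightarrow> {\<delta>. smooth_field L \<delta> \<and> \<delta> 0 = 0 \<and> \<delta> L = 0} \<subseteq> V\<phi> t"
    and "\<And>t. t \<in> T \<Longrightarrow> {\<delta>. smooth_field L \<delta> \<and> \<delta> 0 = 0 \<and> \<delta> L = 0} \<subseteq> V\<theta> t"
    and bc_phi: "\<And>t \<delta>\<phi> S. t \<in> T \<Longrightarrow> \<delta>\<phi> \<in> V\<phi> t \<Longrightarrow> S \<in> {0, L} \<Longrightarrow>
           \<delta>\<phi> S \<bullet> tensor \<GG> (R t S) (strain L (\<phi> t) (R t) S) = 0"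
    and bc_theta: "\<And>t \<delta>\<theta> S. t \<in> T \<Longrightarrow> \<delta>\<theta> \<in> V\<theta> t \<Longrightarrow> S \<in> {0, L} \<Longrightarrow>
           \<delta>\<theta> S \<bullet> tensor \<HH> (R t S) (curvature L (R t) S) = 0"
  shows "(\<exists>dH. \<forall>t\<in>T. is_gradient L (V\<phi> t) (V\<theta> t) H (\<phi> t) (p t) (R t) (\<sigma> t) (dH t)) \<and>
    (\<forall>dH. (\<forall>t\<in>T. is_gradient L (V\<phi> t) (V\<theta> t) H (\<phi> t) (p t) (R t) (\<sigma> t) (dH t)) \<longrightarrow>
      (\<forall>t\<in>T. coordinate_brackets_from_bracket L (R t) (dH t)) \<and>
      (\<forall>t\<in>T. \<forall>S\<in>{0..L}.
         bracket_phi (dH t) S = tensor (matrix_inv \<AA>) (R t S) (p t S) \<and>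
         bracket_p (dH t) S = dS L (\<lambda>S. tensor \<GG> (R t S) (strain L (\<phi> t) (R t) S)) S \<and>
         bracket_R (R t) (dH t) S
           = R t S ** bold_jinv (R t S) (tensor (matrix_inv \<JJ>) (R t S) (\<sigma> t S)) \<and>
         bracket_sigma (R t) (dH t) S
           = dS L (\<lambda>S. tensor \<HH> (R t S) (curvature L (R t) S)) S
             + cross3 (dS L (\<phi> t) S) (tensor \<GG> (R t S) (strain L (\<phi> t) (R t) S))) \<and>
      ((\<forall>t\<in>T. \<forall>S\<in>{0..L}.
          ((\<lambda>t. \<phi> t S) has_vector_derivative
             tensor (matrix_inv \<AA>) (R t S) (p t S)) (at t within T) \<and>
          ((\<lambda>t. p t S) has_vector_derivative
             dS L (\<lambda>S. tensor \<GG> (R t S) (strain L (\<phi> t) (R t) S)) S) (at t within T) \<and>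
          ((\<lambda>t. R t S) has_vector_derivative
             R t S ** bold_jinv (R t S) (tensor (matrix_inv \<JJ>) (R t S) (\<sigma> t S))) (at t within T) \<and>
          ((\<lambda>t. \<sigma> t S) has_vector_derivative
             dS L (\<lambda>S. tensor \<HH> (R t S) (curvature L (R t) S)) S
             + cross3 (dS L (\<phi> t) S) (tensor \<GG> (R t S) (strain L (\<phi> t) (R t) S))) (at t within T))
       \<longleftrightarrow>
       (\<forall>t\<in>T. \<forall>S\<in>{0..L}.
          ((\<lambda>t. \<phi> t S) has_vector_derivative bracket_phi (dH t) S) (at t within T) \<and>
          ((\<lambda>t. p t S) has_vector_derivative bracket_p (dH t) S) (at t within T) \<and>
          ((\<lambda>t. R t S) has_vector_derivative bracket_R (R t) (dH t) S) (at t within T) \<and>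
          ((\<lambda>t. \<sigma> t S) has_vector_derivative bracket_sigma (R t) (dH t) S) (at t within T))))"
proof -
  have rod: "rod_configuration L (\<phi> t) (p t) (\<sigma> t) (R t) \<AA> \<JJ> \<GG> \<HH> (inverse (\<rho> * A))"
    if t: "t \<in> T" for t
  proof
    show "matrix_inv \<AA> = inverse (\<rho> * A) *\<^sub>R mat 1"
      using assms by (simp add: matrix_inv_scaleR_mat)
    show "transpose (matrix_inv \<JJ>) = matrix_inv \<JJ>"
      using assms by (simp add: matrix_inv_scaled_diag3 transpose_diag3)
    show "transpose \<GG> = \<GG>" "transpose \<HH> = \<HH>"
      using assms by (simp_all add: transpose_diag3)
    show "smooth_field L (\<phi> t)" "smooth_field L (p t)" "smooth_field L (\<sigma> t)" "smooth_field L (R t)"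
      using assms t by (auto intro: smooth_family_imp_smooth_field)
  qed (use assms t in auto)
  have gradient: "\<exists>d. is_gradient L (V\<phi> t) (V\<theta> t) H (\<phi> t) (p t) (R t) (\<sigma> t) d"
    and brackets: "is_gradient L (V\<phi> t) (V\<theta> t) H (\<phi> t) (p t) (R t) (\<sigma> t) d \<Longrightarrow>
      coordinate_brackets_from_bracket L (R t) d \<and>
      (\<forall>S\<in>{0..L}.
         bracket_phi d S = tensor (matrix_inv \<AA>) (R t S) (p t S) \<and>
         bracket_p d S = dS L (\<lambda>S. tensor \<GG> (R t S) (strain L (\<phi> t) (R t) S)) S \<and>
         bracket_R (R t) d S
           = R t S ** bold_jinv (R t S) (tensor (matrix_inv \<JJ>) (R t S) (\<sigma> t S)) \<and>
         bracket_sigma (R t) d S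
           = dS L (\<lambda>S. tensor \<HH> (R t S) (curvature L (R t) S)) S
             + cross3 (dS L (\<phi> t) S) (tensor \<GG> (R t S) (strain L (\<phi> t) (R t) S)))"
    if t: "t \<in> T" for t d
  proof -
    interpret rod: rod_configuration L "\<phi> t" "p t" "\<sigma> t" "R t" \<AA> \<JJ> \<GG> \<HH> "inverse (\<rho> * A)"
      by (rule rod[OF t])
    note V = assms(21,22)[OF t] and V0 = assms(23,24)[OF t]
    have bc: "\<delta> S \<bullet> tensor \<GG> (R t S) (strain L (\<phi> t) (R t) S) = 0" if "\<delta> \<in> V\<phi> t" "S \<in> {0, L}" for \<delta> S
      using bc_phi t that by blast
    have bc': "\<delta> S \<bullet> tensor \<HH> (R t S) (curvature L (R t) S) = 0" if "\<delta> \<in> V\<theta> t" "S \<in> {0, L}" for \<delta> S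
      using bc_theta t that by blast
    show "\<exists>d. is_gradient L (V\<phi> t) (V\<theta> t) H (\<phi> t) (p t) (R t) (\<sigma> t) d"
      unfolding H_def by (rule exI, rule rod.is_gradient_H[OF V]) (fact bc bc')+
    assume d: "is_gradient L (V\<phi> t) (V\<theta> t) H (\<phi> t) (p t) (R t) (\<sigma> t) d"
    show "coordinate_brackets_from_bracket L (R t) d \<and>
      (\<forall>S\<in>{0..L}.
         bracket_phi d S = tensor (matrix_inv \<AA>) (R t S) (p t S) \<and>
         bracket_p d S = dS L (\<lambda>S. tensor \<GG> (R t S) (strain L (\<phi> t) (R t) S)) S \<and>
         bracket_R (R t) d S
           = R t S ** bold_jinv (R t S) (tensor (matrix_inv \<JJ>) (R t S) (\<sigma> t S)) \<and>
         bracket_sigma (R t) d S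
           = dS L (\<lambda>S. tensor \<HH> (R t S) (curvature L (R t) S)) S
             + cross3 (dS L (\<phi> t) S) (tensor \<GG> (R t S) (strain L (\<phi> t) (R t) S)))"
      by (intro conjI ballI rod.brackets_H[OF V _ _ d[unfolded H_def] V0] bc bc')
  qed
  have "\<exists>dH. \<forall>t\<in>T. is_gradient L (V\<phi> t) (V\<theta> t) H (\<phi> t) (p t) (R t) (\<sigma> t) (dH t)"
    using gradient by metis
  \<comment> \<open>Once each bracket is known at every point, the two systems in the equivalence
    have the same right-hand sides.\<close>
  then show ?thesis
    using brackets by simp
qed

end
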